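(* Let $R\subset\mathbb N$ be a set of Bohr recurrence. Then for every integer $s\ge1$, every minimal $s$-step nilsystem $(X,T)$ and every nonempty open $U\subset X$, there exists $n\in R$ with $U\cap T^{-n}U\ne\emptyset$.
   Context: For $t\in\mathbb R$ (or $t\in\mathbb T=\mathbb R/\mathbb Z$), $\|t\|$ denotes the distance to the nearest integer. $R\subset\mathbb N$ is a set of Bohr recurrence if for every $k\in\mathbb N$, all $\alpha_1,\dots,\alpha_k\in\mathbb T$ and every $\varepsilon>0$ there is $n\in R$ with $\|n\alpha_i\|<\varepsilon$ for $i=1,\dots,k$. For a group $G$, $G_1=G$ and $G_{j+1}=[G,G_j]$ (generated by commutators $aba^{-1}b^{-1}$); $G$ is $s$-step nilpotent if $G_{s+1}$ is trivial. An $s$-step nilsystem is $(X,T)$ where $X=G/\Gamma$, $G$ is an $s$-step nilpotent Lie group (not necessarily connected), $\Gamma$ a discrete cocompact subgroup, and $Tx=\tau\cdot x$ for a fixed $\tau\in G$. Minimal means no proper nonempty closed invariant subset. *)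

theory Defs
  imports "HOL-Analysis.Analysis"
begin

text \<open>Groups are written additively via the type class group_add, which does NOT
  assume commutativity; so x + y denotes the (possibly non-commutative) group product,
  - x the inverse and 0 the identity.\<close>

definition dist_int :: "real \<Rightarrow> real" where
  "dist_int t = \<bar>t - of_int (round t)\<bar>"

definition bohr_recurrent :: "nat set \<Rightarrow> bool" where
  "bohr_recurrent R \<longleftrightarrow>
     (\<forall>k::nat. \<forall>\<alpha>::nat \<Rightarrow> real. \<forall>\<epsilon>>0.
        \<exists>n\<in>R. \<forall>i<k. dist_int (real n * \<alpha> i) < \<epsilon>)"

inductive_set gen_subgroup :: "'g::group_add set \<Rightarrow> 'g set" for S where
  zero: "0 \<in> gen_subgroup S"
| base: "x \<in> S \<Longrightarrow> x \<in> gen_subgroup S"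
| add: "x \<in> gen_subgroup S \<Longrightarrow> y \<in> gen_subgroup S \<Longrightarrow> x + y \<in> gen_subgroup S"
| inv: "x \<in> gen_subgroup S \<Longrightarrow> - x \<in> gen_subgroup S"

text \<open>lcs j is G_{j+1}: lcs 0 = G, lcs (j+1) = [G, lcs j], generated by
  commutators a b a^{-1} b^{-1}.\<close>
fun lcs :: "nat \<Rightarrow> 'g::group_add set" where
  "lcs 0 = UNIV"
| "lcs (Suc j) = gen_subgroup {a + b + - a + - b | a b. b \<in> lcs j}"

definition nilpotent_step :: "nat \<Rightarrow> 'g::group_add itself \<Rightarrow> bool" where
  "nilpotent_step s _ \<longleftrightarrow> (lcs s :: 'g set) = {0}"

coinductive smooth_on :: "'a::real_normed_vector set \<Rightarrow> ('a \<Rightarrow> 'b::real_normed_vector) \<Rightarrow> bool"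
  where
  "\<lbrakk>continuous_on S f; \<forall>x\<in>S. (f has_derivative f' x) (at x);
    \<forall>v. smooth_on S (\<lambda>x. f' x v)\<rbrakk> \<Longrightarrow> smooth_on S f"

definition topological_group :: "'g::{group_add,topological_space} itself \<Rightarrow> bool" where
  "topological_group _ \<longleftrightarrow>
     continuous_on (UNIV :: ('g \<times> 'g) set) (\<lambda>p. fst p + snd p) \<and>
     continuous_on (UNIV :: 'g set) uminus"

definition is_chart :: "'g::topological_space set \<Rightarrow> ('g \<Rightarrow> 'e::euclidean_space) \<Rightarrow> bool" where
  "is_chart W \<phi> \<longleftrightarrow> open W \<and> open (\<phi> ` W) \<and> (\<exists>\<psi>. homeomorphism W (\<phi> ` W) \<phi> \<psi>)"

definition lie_atlas :: "('g::{group_add,topological_space} set \<times> ('g \<Rightarrow> 'e::euclidean_space)) set \<Rightarrow> bool" where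
  "lie_atlas A \<longleftrightarrow>
     (\<forall>(W,\<phi>)\<in>A. is_chart W \<phi>) \<and>
     (\<Union>(W,\<phi>)\<in>A. W) = UNIV \<and>
     (\<forall>(W1,\<phi>1)\<in>A. \<forall>(W2,\<phi>2)\<in>A.
        smooth_on (\<phi>1 ` (W1 \<inter> W2)) (\<phi>2 \<circ> inv_into W1 \<phi>1)) \<and>
     (\<forall>(W1,\<phi>1)\<in>A. \<forall>(W2,\<phi>2)\<in>A. \<forall>(W3,\<phi>3)\<in>A.
        smooth_on {(a,b). a \<in> \<phi>1 ` W1 \<and> b \<in> \<phi>2 ` W2 \<and>
                          inv_into W1 \<phi>1 a + inv_into W2 \<phi>2 b \<in> W3}
                  (\<lambda>(a,b). \<phi>3 (inv_into W1 \<phi>1 a + inv_into W2 \<phi>2 b))) \<and>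
     (\<forall>(W1,\<phi>1)\<in>A. \<forall>(W2,\<phi>2)\<in>A.
        smooth_on {a. a \<in> \<phi>1 ` W1 \<and> - inv_into W1 \<phi>1 a \<in> W2}
                  (\<lambda>a. \<phi>2 (- inv_into W1 \<phi>1 a)))"

text \<open>A Lie group: a Hausdorff second countable topological group which is either
  discrete (dimension 0) or carries a smooth atlas modelled on 'e compatible with
  the group operations.\<close>
definition lie_group :: "'e::euclidean_space itself \<Rightarrow> 'g::{group_add,topological_space} itself \<Rightarrow> bool" where
  "lie_group _ _ \<longleftrightarrow>
     topological_group TYPE('g) \<and>
     Hausdorff_space (euclidean :: 'g topology) \<and>
     second_countable (euclidean :: 'g topology) \<and>
     ((\<forall>x::'g. open {x}) \<or> (\<exists>A :: ('g set \<times> ('g \<Rightarrow> 'e)) set. lie_atlas A))"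

definition subgroup_of :: "'g::group_add set \<Rightarrow> bool" where
  "subgroup_of H \<longleftrightarrow> 0 \<in> H \<and> (\<forall>x\<in>H. \<forall>y\<in>H. x + y \<in> H) \<and> (\<forall>x\<in>H. - x \<in> H)"

definition cosets :: "'g::group_add set \<Rightarrow> 'g set set" where
  "cosets \<Gamma> = {((+) g) ` \<Gamma> | g. True}"

text \<open>Quotient topology on G/\<Gamma>: U open iff its preimage (the union of its members) is open.\<close>
definition quot_top :: "'g::{group_add,topological_space} set \<Rightarrow> 'g set topology" where
  "quot_top \<Gamma> = topology (\<lambda>U. U \<subseteq> cosets \<Gamma> \<and> open (\<Union>U))"

definition discrete_cocompact :: "'g::{group_add,topological_space} set \<Rightarrow> bool" where
  "discrete_cocompact \<Gamma> \<longleftrightarrow> subgroup_of \<Gamma> \<and>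
     subtopology euclidean \<Gamma> = discrete_topology \<Gamma> \<and>
     compact_space (quot_top \<Gamma>)"

definition transl :: "'g::group_add \<Rightarrow> 'g set \<Rightarrow> 'g set" where
  "transl \<tau> C = ((+) \<tau>) ` C"

definition minimal_nilsystem :: "'g::{group_add,topological_space} set \<Rightarrow> 'g \<Rightarrow> bool" where
  "minimal_nilsystem \<Gamma> \<tau> \<longleftrightarrow>
     (\<forall>A. closedin (quot_top \<Gamma>) A \<and> A \<noteq> {} \<and> transl \<tau> ` A \<subseteq> A \<longrightarrow> A = cosets \<Gamma>)"

end

theory Submission
  imports Defs
begin

text \<open>Write the group additively, let \<open>D\<close> be the set of elements having arbitrarily small
  \<open>n\<close>-th roots for all large \<open>n\<close> (a neighbourhood of \<open>0\<close> in a Lie group) and let \<open>H\<close> be the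
  open subgroup generated by \<open>D\<close> and \<open>\<tau>\<close>; by minimality \<open>H + \<Gamma>\<close> is everything. Let \<open>low k\<close> be the
  descending central series of \<open>H\<close>, started at the subgroup generated by \<open>D\<close>. By induction on
  \<open>k\<close>, some conjugate of \<open>n \<tau>\<close>, with \<open>n \<in> R\<close>, by a small element lies in \<open>W + low k + \<Gamma>\<close>.

  For \<open>k = 1\<close> the group \<open>H / low 1\<close> is abelian, the set \<open>S\<close> of return times to a small set is
  syndetic, and Bogolyubov's argument finds a Bohr set in \<open>S + S - S - S\<close>. For the step, conjugating by a further
  \<open>h \<in> low (k-1)\<close> adds \<open>n [\<tau>, h]\<close> modulo \<open>low (k+1)\<close>. Since every element of \<open>low (k-1)\<close> is
  modulo \<open>low k\<close> an \<open>n\<close>-fold multiple of a small one, this correction reaches all \<open>[\<tau>, h]\<close>, so it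
  suffices that \<open>[\<tau>, low (k-1)] + low (k+1) + \<Gamma>\<close> is dense around \<open>low k\<close>. By density of
  \<open>\<int> \<tau> + \<Gamma>\<close> its closure contains the iterated commutators \<open>[g, \<gamma>, \<dots>, \<gamma>']\<close> with
  lattice entries, and these are replaced by arbitrary entries one after the other: if \<open>g = n g'\<close>, then
  multilinearity moves \<open>n\<close> to the entry \<open>x\<close>, where \<open>n x\<close> stays in a compact set modulo \<open>\<Gamma>\<close>
  while \<open>g'\<close> tends to \<open>0\<close>.\<close>

section \<open>Differences of syndetic sets contain Bohr sets\<close>

text \<open>Orthogonality of the characters of Z/N: a geometric sum whose ratio is an
  \<open>N\<close>-th root of unity other than 1.\<close>

lemma sum_cis_eq_0:
  fixes t :: int
  assumes N: "N > 0" and t: "\<not> int N dvd t"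
  shows "(\<Sum>r<N. cis (2 * pi * real r * of_int t / real N)) = 0"
proof -
  define z where "z = cis (2 * pi * of_int t / real N)"
  have pow: "cis (2 * pi * real r * of_int t / real N) = z ^ r" for r
  proof -
    have "2 * pi * real r * of_int t / real N = real r * (2 * pi * of_int t / real N)" by simp
    then show ?thesis by (simp only: z_def Complex.DeMoivre)
  qed
  have "z ^ N = cis (2 * pi * of_int t)"
    using N by (simp add: z_def Complex.DeMoivre)
  then have zN: "z ^ N = 1"
    by (simp add: cis_multiple_2pi)
  have "z \<noteq> 1"
  proof
    assume "z = 1"
    then have "cos (2 * pi * of_int t / real N) = 1"
      by (simp add: z_def complex_eq_iff)
    then obtain k :: int where "2 * pi * of_int t / real N = of_int k * 2 * pi"
      using cos_one_2pi_int by blast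
    then have "real_of_int t = of_int (k * int N)"
      using N by (simp add: field_simps)
    then have "t = k * int N" by linarith
    with t show False by simp
  qed
  then show ?thesis
    unfolding pow using zN by (simp add: geometric_sum)
qed

lemma dist_int_add_le: "dist_int (x + y) \<le> dist_int x + \<bar>y\<bar>"
proof -
  have "dist_int (x + y) \<le> \<bar>x + y - of_int (round x)\<bar>"
    unfolding dist_int_def using round_diff_minimal[of "x + y" "round x"] by simp
  then show ?thesis unfolding dist_int_def by linarith
qed

lemma cos_2pi_nonneg:
  assumes "dist_int x \<le> 1/4"
  shows "0 \<le> cos (2 * pi * x)"
proof -
  define y where "y = x - of_int (round x)"
  have "\<bar>y\<bar> \<le> 1/4" using assms by (simp add: dist_int_def y_def)
  then have y: "- (1/4) \<le> y" "y \<le> 1/4" by linarith+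
  have "- (pi/2) \<le> 2 * pi * y" "2 * pi * y \<le> pi/2"
    using mult_left_mono[OF y(1), of "2*pi"] mult_left_mono[OF y(2), of "2*pi"] by auto
  then have "0 \<le> cos (2 * pi * y)"
    by (intro cos_ge_zero) auto
  moreover have "2 * pi * x = 2 * pi * y + of_int (round x) * (2 * pi)"
    by (simp add: y_def algebra_simps)
  then have "cos (2 * pi * x) = cos (2 * pi * y)"
    using cos_eq_periodic_intro[of "2 * pi * x" "2*pi*y" "round x"]
    by (metis cos_int_2pin cos_add mult.commute sin_int_2pin mult_zero_right diff_zero mult.right_neutral)
  ultimately show ?thesis by simp
qed

text \<open>Bogolyubov's argument in Z/N. Since \<open>4 * M \<le> N\<close>, the relation
  \<open>n + c + d = a + b\<close> holds modulo \<open>N\<close> only if it holds in the integers.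
  Up to the factor \<open>N\<close>, the number of its solutions is the sum over \<open>r\<close> of
  |F(r)|^4 cos(2 pi r n / N). Frequencies in the large spectrum \<open>L\<close> contribute
  nonnegatively, and the others cannot cancel the main term at \<open>r = 0\<close>.\<close>

lemma large_spectrum:
  fixes A :: "nat set" and N M m :: nat
  assumes A: "A \<subseteq> {..<M}" "A \<noteq> {}" and MN: "4 * M \<le> N" and dens: "N \<le> 8 * m * card A"
  shows "\<exists>L. L \<subseteq> {..<N} \<and> card L \<le> 128 * m ^ 2 \<and>
    (\<forall>n<M. (\<forall>r\<in>L. dist_int (real n * (real r / real N)) \<le> 1/4) \<longrightarrow>
       (\<exists>a\<in>A. \<exists>b\<in>A. \<exists>c\<in>A. \<exists>d\<in>A. n + c + d = a + b))"
proof -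
  define F where "F r = (\<Sum>a\<in>A. cis (2 * pi * real r * real a / real N))" for r :: nat
  define q where "q = real (card A)"
  \<comment> \<open>This threshold makes the frequencies outside \<open>L\<close> contribute at most
    \<open>\<eta> * N * q \<le> q^4 / 2\<close>, half of the main term.\<close>
  define \<eta> where "\<eta> = q\<^sup>2 / (16 * real m)"
  define L where "L = {r. r < N \<and> (norm (F r))\<^sup>2 \<ge> \<eta>}"
  have finA: "finite A" using A finite_subset by blast
  have q0: "q > 0" using finA A by (simp add: q_def card_gt_0_iff)
  have M0: "M > 0" using A by (cases M) auto
  have N0: "N > 0" using M0 MN by simp
  have m0: "m > 0" using dens N0 by (cases m) auto
  have Nq: "real N \<le> 8 * real m * q"
    using dens unfolding q_def by (metis of_nat_le_iff of_nat_mult of_nat_numeral)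
  have sq: "complex_of_real ((norm (F r))\<^sup>2) =
      (\<Sum>a\<in>A. \<Sum>b\<in>A. cis (2 * pi * real r * of_int (int a - int b) / real N))" for r
  proof -
    have "complex_of_real ((norm (F r))\<^sup>2) = F r * cnj (F r)"
      using complex_norm_square[of "F r"] by simp
    also have "\<dots> = (\<Sum>a\<in>A. \<Sum>b\<in>A. cis (2 * pi * real r * real a / real N)
                         * cnj (cis (2 * pi * real r * real b / real N)))"
      unfolding F_def by (simp add: sum_product)
    also have "\<dots> = (\<Sum>a\<in>A. \<Sum>b\<in>A. cis (2 * pi * real r * of_int (int a - int b) / real N))"
      by (intro sum.cong refl)
        (simp add: cis_cnj cis_mult diff_divide_distrib right_diff_distrib)
    finally show ?thesis .
  qed
  \<comment> \<open>Parseval's identity: only the diagonal \<open>a = b\<close> survives, because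
    differences in \<open>A\<close> are smaller than \<open>N\<close>.\<close>
  have pars: "(\<Sum>r<N. (norm (F r))\<^sup>2) = real N * q"
  proof -
    have "complex_of_real (\<Sum>r<N. (norm (F r))\<^sup>2) =
       (\<Sum>r<N. \<Sum>a\<in>A. \<Sum>b\<in>A. cis (2 * pi * real r * of_int (int a - int b) / real N))"
      by (simp add: sq del: of_real_power)
    also have "\<dots> = (\<Sum>a\<in>A. \<Sum>b\<in>A. \<Sum>r<N. cis (2 * pi * real r * of_int (int a - int b) / real N))"
      by (rule trans[OF sum.swap], rule sum.cong[OF refl], rule sum.swap)
    also have "\<dots> = (\<Sum>a\<in>A. \<Sum>b\<in>A. if b = a then of_nat N else 0)"
    proof (intro sum.cong refl)
      fix a b assume ab: "a \<in> A" "b \<in> A"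
      show "(\<Sum>r<N. cis (2 * pi * real r * of_int (int a - int b) / real N)) = (if b = a then of_nat N else 0)"
      proof (cases "b = a")
        case False
        have "a < M" "b < M" using ab A by auto
        then have "\<bar>int a - int b\<bar> < int N" using MN M0 by linarith
        then have "\<not> int N dvd (int a - int b)"
          using False zdvd_imp_le[of "int N" "\<bar>int a - int b\<bar>"] by auto
        then show ?thesis using sum_cis_eq_0[OF N0, of "int a - int b"] False by simp
      qed simp
    qed
    also have "\<dots> = complex_of_real (real N * q)"
      using finA by (simp add: q_def)
    finally show ?thesis by (metis of_real_eq_iff)
  qed
  have finL: "finite L" unfolding L_def by auto
  have cardL: "card L \<le> 128 * m ^ 2"
  proof -
    have "real (card L) * \<eta> \<le> (\<Sum>r\<in>L. (norm (F r))\<^sup>2)"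
      using sum_bounded_below[of L \<eta> "\<lambda>r. (norm (F r))\<^sup>2"] unfolding L_def by auto
    also have "\<dots> \<le> (\<Sum>r<N. (norm (F r))\<^sup>2)"
      by (intro sum_mono2) (auto simp: L_def)
    also have "\<dots> \<le> 8 * real m * q * q"
      unfolding pars using Nq q0 by (simp add: mult_right_mono)
    finally have "real (card L) * q\<^sup>2 \<le> 128 * (real m)\<^sup>2 * q\<^sup>2"
      using m0 by (simp add: \<eta>_def field_simps power2_eq_square)
    then have "real (card L) \<le> 128 * (real m)\<^sup>2" using q0 by simp
    then have "real (card L) \<le> real (128 * m ^ 2)" by simp
    then show ?thesis by linarith
  qed
  have main: "\<exists>a\<in>A. \<exists>b\<in>A. \<exists>c\<in>A. \<exists>d\<in>A. n + c + d = a + b"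
    if n: "n < M" and close: "\<forall>r\<in>L. dist_int (real n * (real r / real N)) \<le> 1/4" for n
  proof (rule ccontr)
    assume neg: "\<not> ?thesis"
    define G where "G r = (norm (F r))\<^sup>2 * (norm (F r))\<^sup>2 * cos (2 * pi * (real n * (real r / real N)))" for r
    \<comment> \<open>Without a solution every inner sum over \<open>r\<close> vanishes, so the
      Fourier expression counting the solutions is 0.\<close>
    have "(\<Sum>r<N. complex_of_real ((norm (F r))\<^sup>2) * complex_of_real ((norm (F r))\<^sup>2)
             * cis (- (2 * pi * real r * real n / real N)))
       = (\<Sum>r<N. \<Sum>a\<in>A. \<Sum>b\<in>A. \<Sum>c\<in>A. \<Sum>d\<in>A.
            cis (2 * pi * real r * of_int (int a - int c + (int b - int d) - int n) / real N))"
      unfolding sq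
      by (intro sum.cong refl)
        (simp add: sum_product sum_distrib_right sum_distrib_left cis_mult
           add_divide_distrib diff_divide_distrib distrib_left right_diff_distrib algebra_simps)
    also have "\<dots> = (\<Sum>a\<in>A. \<Sum>b\<in>A. \<Sum>c\<in>A. \<Sum>d\<in>A. \<Sum>r<N.
            cis (2 * pi * real r * of_int (int a - int c + (int b - int d) - int n) / real N))"
      by (rule trans[OF sum.swap], rule sum.cong[OF refl], rule trans[OF sum.swap],
          rule sum.cong[OF refl], rule trans[OF sum.swap], rule sum.cong[OF refl], rule sum.swap)
    also have "\<dots> = 0"
    proof (rule sum.neutral, rule ballI, rule sum.neutral, rule ballI, rule sum.neutral, rule ballI,
        rule sum.neutral, rule ballI)
      fix a b c d assume mem: "a \<in> A" "b \<in> A" "c \<in> A" "d \<in> A"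
      let ?t = "int a - int c + (int b - int d) - int n"
      have lt: "a < M" "b < M" "c < M" "d < M" using mem A by auto
      have "n + c + d \<noteq> a + b" using neg mem by blast
      then have "?t \<noteq> 0" by linarith
      moreover have "\<bar>?t\<bar> < int N" using lt n MN by linarith
      ultimately have "\<not> int N dvd ?t"
        using zdvd_imp_le[of "int N" "\<bar>?t\<bar>"] by auto
      then show "(\<Sum>r<N. cis (2 * pi * real r * of_int ?t / real N)) = 0"
        by (rule sum_cis_eq_0[OF N0])
    qed
    finally have "Re (\<Sum>r<N. complex_of_real ((norm (F r))\<^sup>2) * complex_of_real ((norm (F r))\<^sup>2)
             * cis (- (2 * pi * real r * real n / real N))) = 0" by simp
    moreover have "Re (complex_of_real ((norm (F r))\<^sup>2) * complex_of_real ((norm (F r))\<^sup>2)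
             * cis (- (2 * pi * real r * real n / real N))) = G r" for r
      unfolding G_def by (simp add: mult_ac flip: of_real_mult of_real_power)
    ultimately have zero: "(\<Sum>r<N. G r) = 0" by simp
    have F0: "F 0 = of_real q" by (simp add: F_def q_def)
    have G0: "G 0 = q ^ 4" using q0 by (simp add: G_def F0 power4_eq_xxxx power2_eq_square)
    \<comment> \<open>Outside \<open>L\<close> one factor |F(r)|^2 is bounded by \<eta>, which
      leaves the other one for Parseval.\<close>
    have Gr: "G r \<ge> - (\<eta> * (norm (F r))\<^sup>2)" if "r < N" for r
    proof (cases "r \<in> L")
      case True
      then have "cos (2 * pi * (real n * (real r / real N))) \<ge> 0"
        using close cos_2pi_nonneg by blast
      then have "G r \<ge> 0" by (simp add: G_def)
      moreover have "\<eta> * (norm (F r))\<^sup>2 \<ge> 0" by (simp add: \<eta>_def)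
      ultimately show ?thesis by linarith
    next
      case False
      then have le: "(norm (F r))\<^sup>2 \<le> \<eta>" using that by (simp add: L_def)
      have "- G r \<le> (norm (F r))\<^sup>2 * (norm (F r))\<^sup>2 * 1"
        unfolding G_def minus_mult_right
        by (intro mult_left_mono) (auto simp: minus_le_iff)
      also have "\<dots> \<le> \<eta> * (norm (F r))\<^sup>2"
        using mult_right_mono[OF le, of "(norm (F r))\<^sup>2"] by simp
      finally show ?thesis by linarith
    qed
    have "(\<Sum>r\<in>{..<N} - {0}. G r) \<ge> (\<Sum>r\<in>{..<N} - {0}. - (\<eta> * (norm (F r))\<^sup>2))"
      by (intro sum_mono) (use Gr in auto)
    moreover have "(\<Sum>r\<in>{..<N} - {0}. - (\<eta> * (norm (F r))\<^sup>2)) = - (\<eta> * (\<Sum>r\<in>{..<N} - {0}. (norm (F r))\<^sup>2))"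
      by (simp add: sum_negf sum_distrib_left)
    moreover have "(\<Sum>r\<in>{..<N} - {0}. (norm (F r))\<^sup>2) \<le> real N * q"
      unfolding pars[symmetric] by (intro sum_mono2) auto
    then have "\<eta> * (\<Sum>r\<in>{..<N} - {0}. (norm (F r))\<^sup>2) \<le> \<eta> * (real N * q)"
      by (intro mult_left_mono) (auto simp: \<eta>_def)
    moreover have "(\<Sum>r<N. G r) = G 0 + (\<Sum>r\<in>{..<N} - {0}. G r)"
      using N0 by (intro sum.remove) auto
    ultimately have "q ^ 4 \<le> \<eta> * (real N * q)" using zero G0 by linarith
    also have "\<dots> \<le> \<eta> * (8 * real m * q * q)"
      using Nq q0 by (intro mult_left_mono mult_right_mono) (auto simp: \<eta>_def)
    also have "\<dots> = q ^ 4 / 2"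
      using m0 by (simp add: \<eta>_def power4_eq_xxxx power2_eq_square)
    finally show False using q0 by simp
  qed
  have "L \<subseteq> {..<N}" by (auto simp: L_def)
  then show ?thesis using cardL main by blast
qed

lemma convergent_subseq_finite:
  fixes f :: "nat \<Rightarrow> nat \<Rightarrow> real"
  assumes "\<And>q i. f q i \<in> {0..1}"
  shows "\<exists>\<rho>::nat \<Rightarrow> nat. strict_mono \<rho> \<and> (\<exists>\<alpha>. \<forall>i<K. (\<lambda>q. f (\<rho> q) i) \<longlonglongrightarrow> \<alpha> i)"
proof (induction K)
  case 0
  show ?case by (intro exI[of _ id]) (auto simp: strict_mono_def)
next
  case (Suc K)
  then obtain \<rho> \<alpha> where \<rho>: "strict_mono \<rho>" and \<alpha>: "\<And>i. i < K \<Longrightarrow> (\<lambda>q. f (\<rho> q) i) \<longlonglongrightarrow> \<alpha> i"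
    by blast
  have "bounded (range (\<lambda>q. f (\<rho> q) K))"
    by (rule bounded_subset[of "{0..1}"]) (use assms in auto)
  then obtain l \<sigma> where \<sigma>: "strict_mono \<sigma>" and l: "((\<lambda>q. f (\<rho> q) K) \<circ> \<sigma>) \<longlonglongrightarrow> l"
    using bounded_imp_convergent_subsequence by blast
  have "(\<lambda>q. f ((\<rho> \<circ> \<sigma>) q) i) \<longlonglongrightarrow> (\<alpha>(K := l)) i" if "i < Suc K" for i
  proof (cases "i = K")
    case False
    then have "i < K" using that by simp
    then show ?thesis using LIMSEQ_subseq_LIMSEQ[OF \<alpha> \<sigma>] False by (simp add: o_def)
  qed (use l in \<open>simp add: o_def\<close>)
  then show ?case using strict_mono_o[OF \<rho> \<sigma>] by blast
qed

text \<open>Each of the \<open>q\<close> consecutive blocks of length \<open>m\<close> contributes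
  an element.\<close>

lemma card_syndetic:
  fixes S :: "nat set"
  assumes "\<And>k. \<exists>i<m. k + i \<in> S"
  shows "q \<le> card (S \<inter> {..<m * q})"
proof (induction q)
  case (Suc q)
  obtain i where i: "i < m" "m * q + i \<in> S" using assms by blast
  have "insert (m * q + i) (S \<inter> {..<m * q}) \<subseteq> S \<inter> {..<m * Suc q}"
    using i by auto
  then have "card (insert (m * q + i) (S \<inter> {..<m * q})) \<le> card (S \<inter> {..<m * Suc q})"
    by (intro card_mono) auto
  then show ?case using Suc by simp
qed simp

text \<open>\<open>large_spectrum\<close> is applied to longer and longer initial pieces of
  \<open>S\<close>. The number of frequencies stays bounded by \<open>K\<close>, which depends on
  the gap \<open>m\<close> only, so a limit of the frequency vectors serves all \<open>n\<close> at
  once; the slack between 1/8 and 1/4 absorbs the error of the limit.\<close>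

lemma syndetic_differences_contain_bohr:
  fixes S :: "nat set"
  assumes synd: "\<And>k. \<exists>i<m. k + i \<in> S"
  shows "\<exists>(K::nat) \<alpha>. \<forall>n. (\<forall>i<K. dist_int (real n * \<alpha> i) < 1/8) \<longrightarrow>
           (\<exists>a\<in>S. \<exists>b\<in>S. \<exists>c\<in>S. \<exists>d\<in>S. n + c + d = a + b)"
proof -
  have m0: "m > 0" using synd[of 0] by auto
  define K where "K = 128 * m ^ 2"
  define N where "N q = 8 * (m * Suc q)" for q
  define P where "P q g \<longleftrightarrow> (\<forall>i::nat. g i \<in> {0..1::real}) \<and>
    (\<forall>n<m * Suc q. (\<forall>i<K. dist_int (real n * g i) \<le> 1/4) \<longrightarrow>
       (\<exists>a\<in>S. \<exists>b\<in>S. \<exists>c\<in>S. \<exists>d\<in>S. n + c + d = a + b))" for q g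
  have "\<exists>g. P q g" for q
  proof -
    let ?M = "m * Suc q"
    have cA: "Suc q \<le> card (S \<inter> {..<?M})" using card_syndetic[OF synd] by blast
    then have "S \<inter> {..<?M} \<noteq> {}" by auto
    moreover have "N q \<le> 8 * m * card (S \<inter> {..<?M})"
      using mult_le_mono2[OF cA, of "8 * m"] by (simp add: N_def algebra_simps)
    ultimately obtain L where L: "L \<subseteq> {..<N q}" "card L \<le> K"
      and LS: "\<And>n. n < ?M \<Longrightarrow> (\<forall>r\<in>L. dist_int (real n * (real r / real (N q))) \<le> 1/4) \<Longrightarrow>
       (\<exists>a\<in>S\<inter> {..<?M}. \<exists>b\<in>S\<inter> {..<?M}. \<exists>c\<in>S\<inter> {..<?M}. \<exists>d\<in>S\<inter> {..<?M}. n + c + d = a + b)"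
      using large_spectrum[of "S \<inter> {..<?M}" ?M "N q" m] unfolding K_def N_def by auto
    obtain h where h: "bij_betw h {..<card L} L"
      using ex_bij_betw_nat_finite[OF finite_subset[OF L(1)]] by (auto simp: lessThan_atLeast0)
    \<comment> \<open>Padding with the frequency 0 gives the vectors of all stages the same length
      \<open>K\<close>.\<close>
    define g where "g i = (if i < card L then real (h i) / real (N q) else 0)" for i
    have "P q g"
      unfolding P_def
    proof (intro conjI allI impI)
      fix i have "h i < N q" if "i < card L" using that h L(1) unfolding bij_betw_def by blast
      then show "g i \<in> {0..1}" by (auto simp: g_def divide_le_eq_1 less_imp_le)
    next
      fix n assume n: "n < ?M" and cl: "\<forall>i<K. dist_int (real n * g i) \<le> 1/4"
      have "\<forall>r\<in>L. dist_int (real n * (real r / real (N q))) \<le> 1/4"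
      proof
        fix r assume "r \<in> L"
        then obtain i where "i < card L" "r = h i" using h unfolding bij_betw_def by auto
        then show "dist_int (real n * (real r / real (N q))) \<le> 1/4"
          using cl[rule_format, of i] L(2) by (simp add: g_def)
      qed
      then show "\<exists>a\<in>S. \<exists>b\<in>S. \<exists>c\<in>S. \<exists>d\<in>S. n + c + d = a + b" using LS[OF n] by blast
    qed
    then show ?thesis by blast
  qed
  then obtain f where f: "\<And>q. P q (f q)" by metis
  have "f q i \<in> {0..1}" for q i using f[of q] by (simp add: P_def)
  then obtain \<rho> \<alpha> where \<rho>: "strict_mono (\<rho> :: nat \<Rightarrow> nat)"
    and \<alpha>: "\<And>i. i < K \<Longrightarrow> (\<lambda>q. f (\<rho> q) i) \<longlonglongrightarrow> \<alpha> i"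
    using convergent_subseq_finite[of f K] by blast
  show ?thesis
  proof (rule exI[of _ K], rule exI[of _ \<alpha>], intro allI impI)
    fix n assume n: "\<forall>i<K. dist_int (real n * \<alpha> i) < 1/8"
    have "\<forall>\<^sub>F q in sequentially. \<forall>i\<in>{..<K}. dist_int (real n * f (\<rho> q) i) \<le> 1/4"
    proof (intro eventually_ball_finite ballI)
      fix i assume "i \<in> {..<K}"
      then have i: "i < K" by simp
      have "(\<lambda>q. real n * f (\<rho> q) i) \<longlonglongrightarrow> real n * \<alpha> i"
        by (intro tendsto_intros \<alpha> i)
      then have "\<forall>\<^sub>F q in sequentially. dist (real n * f (\<rho> q) i) (real n * \<alpha> i) < 1/8"
        by (rule tendstoD) simp
      then show "\<forall>\<^sub>F q in sequentially. dist_int (real n * f (\<rho> q) i) \<le> 1/4"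
      proof eventually_elim
        case (elim q)
        then show ?case
          using dist_int_add_le[of "real n * \<alpha> i" "real n * f (\<rho> q) i - real n * \<alpha> i"] n[rule_format, OF i]
          by (simp add: dist_real_def)
      qed
    qed simp
    moreover have "\<forall>\<^sub>F q in sequentially. q \<ge> n" by (rule eventually_ge_at_top)
    ultimately have "\<forall>\<^sub>F q in sequentially. q \<ge> n \<and> (\<forall>i\<in>{..<K}. dist_int (real n * f (\<rho> q) i) \<le> 1/4)"
      by eventually_elim auto
    then obtain q where q: "q \<ge> n" "\<forall>i<K. dist_int (real n * f (\<rho> q) i) \<le> 1/4"
      by (auto simp: eventually_sequentially)
    \<comment> \<open>\<open>\<rho> q \<ge> q\<close> for a subsequence, so the stage
      \<open>\<rho> q\<close> reaches far enough to cover \<open>n\<close>.\<close>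
    have "n < Suc (\<rho> q)" using q(1) seq_suble[OF \<rho>, of q] by simp
    also have "\<dots> \<le> m * Suc (\<rho> q)" using m0 by (cases m) auto
    finally show "\<exists>a\<in>S. \<exists>b\<in>S. \<exists>c\<in>S. \<exists>d\<in>S. n + c + d = a + b"
      using f[of "\<rho> q"] q(2) unfolding P_def by blast
  qed
qed

text \<open>The extra frequency \<open>1 / n0\<close> with tolerance at most \<open>1 / n0\<close>
  forces \<open>n\<close> to be a multiple of \<open>n0\<close>, and a nonzero one since
  \<open>0 \<notin> R\<close>.\<close>

lemma bohr_recurrent_tail:
  assumes R: "bohr_recurrent R" and "0 \<notin> R" and "n0 > 0"
  shows "bohr_recurrent {n \<in> R. n \<ge> n0}"
  unfolding bohr_recurrent_def
proof (intro allI impI)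
  fix k :: nat and \<alpha> :: "nat \<Rightarrow> real" and \<epsilon> :: real assume \<epsilon>: "\<epsilon> > 0"
  define \<beta> where "\<beta> = \<alpha>(k := 1 / real n0)"
  obtain n where n: "n \<in> R" and cl: "\<And>i. i < Suc k \<Longrightarrow> dist_int (real n * \<beta> i) < min \<epsilon> (1 / real n0)"
  proof -
    have "0 < min \<epsilon> (1 / real n0)" using \<epsilon> \<open>n0 > 0\<close> by simp
    from R[unfolded bohr_recurrent_def, rule_format, OF this, of "Suc k" \<beta>] show ?thesis
      using that by blast
  qed
  define j where "j = round (real n / real n0)"
  have "\<bar>real n / real n0 - of_int j\<bar> < 1 / real n0"
    using cl[of k] by (simp add: \<beta>_def dist_int_def j_def)
  then have "\<bar>(real n / real n0 - of_int j) * real n0\<bar> < 1"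
    using mult_strict_right_mono[of "\<bar>real n / real n0 - of_int j\<bar>" "1 / real n0" "real n0"] \<open>n0 > 0\<close>
    unfolding abs_mult by simp
  then have "\<bar>real n - of_int j * real n0\<bar> < 1"
    using \<open>n0 > 0\<close> by (simp add: left_diff_distrib)
  then have "\<bar>of_int (int n - j * int n0)\<bar> < (1::real)" by simp
  then have nj: "int n = j * int n0" by linarith
  have "n \<noteq> 0" using n \<open>0 \<notin> R\<close> by metis
  then have "int n > 0" by simp
  then have "j \<ge> 1" using nj zero_less_mult_pos2[of j "int n0"] \<open>n0 > 0\<close> by simp
  then have "int n0 \<le> int n" using nj mult_right_mono[of 1 j "int n0"] by simp
  then have "n \<in> {n \<in> R. n \<ge> n0}" using n by simp
  moreover have "dist_int (real n * \<alpha> i) < \<epsilon>" if "i < k" for i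
    using cl[of i] that by (simp add: \<beta>_def)
  ultimately show "\<exists>n\<in>{n \<in> R. n0 \<le> n}. \<forall>i<k. dist_int (real n * \<alpha> i) < \<epsilon>" by blast
qed

section \<open>Small roots in Lie groups\<close>

primrec nmul :: "nat \<Rightarrow> 'g::group_add \<Rightarrow> 'g" where
  "nmul 0 x = 0"
| "nmul (Suc n) x = x + nmul n x"

lemma nmul_zero [simp]: "nmul n (0::'g::group_add) = 0"
  by (induction n) auto

lemma nmul_commute: "nmul n x + x = x + nmul n (x::'g::group_add)"
  by (induction n) (auto simp: add.assoc)

lemma nmul_add: "nmul (m + n) x = nmul m x + nmul n (x::'g::group_add)"
  by (induction m) (auto simp: add.assoc)

lemma nmul_conj: "nmul n (g + x + - g) = g + nmul n x + - (g::'g::group_add)"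
  by (induction n) (auto simp: add.assoc simp del: add_uminus_conv_diff)

lemma continuous_on_group_add:
  assumes "topological_group TYPE('g::{group_add,topological_space})"
    and "continuous_on S f" "continuous_on S g"
  shows "continuous_on S (\<lambda>x. f x + g x :: 'g)"
proof -
  have "continuous_on S (\<lambda>x. (f x, g x))" using assms by (intro continuous_on_Pair)
  then show ?thesis
    using continuous_on_compose2[of UNIV "\<lambda>p::'g\<times>'g. fst p + snd p" S "\<lambda>x. (f x, g x)"] assms(1)
    by (simp add: topological_group_def)
qed

lemma continuous_on_group_minus:
  assumes "topological_group TYPE('g::{group_add,topological_space})"
    and "continuous_on S f"
  shows "continuous_on S (\<lambda>x. - f x :: 'g)"
  using continuous_on_compose2[of UNIV "uminus :: 'g \<Rightarrow> 'g" S f] assms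
  by (simp add: topological_group_def)

lemma continuous_on_nmul:
  assumes "topological_group TYPE('g::{group_add,topological_space})"
    and "continuous_on S f"
  shows "continuous_on S (\<lambda>x. nmul n (f x) :: 'g)"
  by (induction n) (auto intro: continuous_on_group_add assms)

text \<open>The set \<open>D\<close> of the overview. Asking for roots for all large
  \<open>n\<close>, and not just for infinitely many, lets finitely many such conditions be met by a
  common \<open>n\<close>.\<close>

definition small_divisible :: "'g::{group_add,topological_space} set" where
  "small_divisible = {x. \<forall>V. open V \<longrightarrow> 0 \<in> V \<longrightarrow> (\<forall>\<^sub>F n in sequentially. \<exists>h\<in>V. nmul n h = x)}"

lemma zero_small_divisible: "0 \<in> small_divisible"
  unfolding small_divisible_def by (auto intro!: always_eventually bexI[of _ 0])

text \<open>In the chart the product \<open>m\<close> satisfies \<open>m (p, b) = b\<close>, so its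
  derivative in the second variable at \<open>(p, p)\<close> is the identity. By continuity of the
  derivative it stays within 1/2 of the identity nearby, and the mean value inequality gives the
  last estimate.\<close>

lemma lie_atlas_chart_estimate:
  fixes A :: "('g::{group_add,topological_space} set \<times> ('g \<Rightarrow> 'e::euclidean_space)) set"
  assumes A: "lie_atlas A" and tg: "topological_group TYPE('g)"
  obtains W :: "'g set" and \<phi> :: "'g \<Rightarrow> 'e" and \<psi> \<delta> where
    "open W" "0 \<in> W" "open (\<phi> ` W)" "homeomorphism W (\<phi> ` W) \<phi> \<psi>" "\<delta> > 0"
    "ball (\<phi> 0) \<delta> \<subseteq> \<phi> ` W"
    "\<And>a b. a \<in> ball (\<phi> 0) \<delta> \<Longrightarrow> b \<in> ball (\<phi> 0) \<delta> \<Longrightarrow> \<psi> a + \<psi> b \<in> W"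
    "\<And>a b. a \<in> ball (\<phi> 0) \<delta> \<Longrightarrow> b \<in> ball (\<phi> 0) \<delta> \<Longrightarrow>
       norm (\<phi> (\<psi> a + \<psi> b) - a - (b - \<phi> 0)) \<le> norm (b - \<phi> 0) / 2"
proof -
  have "0 \<in> (\<Union>(W,\<phi>)\<in>A. W)" using A by (simp add: lie_atlas_def)
  then obtain W \<phi> where WA: "(W, \<phi>) \<in> A" and W0: "0 \<in> W" by auto
  define Q where "Q = \<phi> ` W"
  define \<psi> where "\<psi> = inv_into W \<phi>"
  define p where "p = \<phi> 0"
  have "is_chart W \<phi>" using A WA unfolding lie_atlas_def by blast
  then obtain \<psi>' where oW: "open W" and oQ: "open Q" and hom': "homeomorphism W Q \<phi> \<psi>'"
    unfolding is_chart_def Q_def by blast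
  have inj: "inj_on \<phi> W" using hom' by (metis homeomorphism_apply1 inj_onI)
  have hom: "homeomorphism W Q \<phi> \<psi>"
    by (rule homeomorphism_cong[OF hom' refl refl])
      (auto simp: \<psi>_def Q_def inv_into_f_f[OF inj] homeomorphism_apply1[OF hom'])
  have pQ: "p \<in> Q" using W0 by (simp add: p_def Q_def)
  have \<psi>p: "\<psi> p = 0" using W0 by (simp add: p_def \<psi>_def inv_into_f_f[OF inj])
  have \<phi>\<psi>: "\<phi> (\<psi> a) = a" "\<psi> a \<in> W" if "a \<in> Q" for a
    using homeomorphism_apply2[OF hom that] homeomorphism_image2[OF hom] that by auto
  define S where "S = {(a,b). a \<in> \<phi> ` W \<and> b \<in> \<phi> ` W \<and> \<psi> a + \<psi> b \<in> W}"
  define m where "m = (\<lambda>(a,b). \<phi> (\<psi> a + \<psi> b))"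
  have "smooth_on S m"
    using A WA unfolding lie_atlas_def S_def m_def \<psi>_def by fast
  then obtain f' where der: "\<And>x. x \<in> S \<Longrightarrow> (m has_derivative f' x) (at x)"
    and sm: "\<And>v. smooth_on S (\<lambda>x. f' x v)"
    by (cases rule: smooth_on.cases) auto
  have cf: "continuous_on S (\<lambda>x. f' x v)" for v
    using sm[of v] by (cases rule: smooth_on.cases) auto
  have oS: "open S"
  proof -
    have "continuous_on (Q \<times> Q) (\<lambda>ab. \<psi> (fst ab) + \<psi> (snd ab))"
      by (intro continuous_on_group_add tg continuous_on_compose2[OF homeomorphism_cont2[OF hom]]
          continuous_on_fst continuous_on_snd continuous_on_id) auto
    then have "open (Q \<times> Q \<inter> (\<lambda>ab. \<psi> (fst ab) + \<psi> (snd ab)) -` W)"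
      by (intro continuous_open_preimage open_Times oQ oW)
    moreover have "Q \<times> Q \<inter> (\<lambda>ab. \<psi> (fst ab) + \<psi> (snd ab)) -` W = S"
      by (auto simp: S_def Q_def)
    ultimately show ?thesis by simp
  qed
  have ppS: "(p, p) \<in> S" using pQ W0 by (simp add: S_def \<psi>p Q_def)
  have map: "m (a, p) = a" "m (p, a) = a" if "a \<in> Q" for a
    using that by (simp_all add: m_def \<psi>p \<phi>\<psi>)
  have dpp: "f' (p, p) (0, v) = v" for v
  proof -
    have "((\<lambda>b. m (p, b)) has_derivative (\<lambda>v. f' (p, p) (0, v))) (at p)"
      by (rule has_derivative_compose[where f="\<lambda>b. (p, b)" and g=m])
        (auto intro!: derivative_eq_intros der[OF ppS])
    moreover have "((\<lambda>b. m (p, b)) has_derivative (\<lambda>v. v)) (at p)"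
      by (rule has_derivative_transform_within_open[OF has_derivative_ident oQ pQ]) (simp add: map)
    ultimately show ?thesis by (metis has_derivative_unique)
  qed
  \<comment> \<open>Each of the \<open>DIM('e)\<close> basis directions may contribute \<eta>, which
    adds up to the operator norm 1/2.\<close>
  define \<eta> where "\<eta> = 1 / (2 * real DIM('e))"
  have \<eta>0: "\<eta> > 0" by (simp add: \<eta>_def)
  have "\<forall>\<^sub>F x in nhds (p, p). \<forall>i\<in>Basis. norm (f' x (0, i) - i) \<le> \<eta>"
  proof (intro eventually_ball_finite ballI)
    fix i :: 'e
    have "continuous (at (p, p)) (\<lambda>x. f' x (0, i))"
      using cf oS ppS continuous_on_eq_continuous_at by blast
    then have "((\<lambda>x. f' x (0, i)) \<longlongrightarrow> f' (p, p) (0, i)) (nhds (p, p))"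
      by (simp only: continuous_at tendsto_at_iff_tendsto_nhds[of "\<lambda>x. f' x (0, i)"])
    then have "\<forall>\<^sub>F x in nhds (p, p). dist (f' x (0, i)) (f' (p, p) (0, i)) < \<eta>"
      using \<eta>0 by (rule tendstoD)
    then show "\<forall>\<^sub>F x in nhds (p, p). norm (f' x (0, i) - i) \<le> \<eta>"
      by eventually_elim (simp add: dpp dist_norm)
  qed simp
  moreover have "\<forall>\<^sub>F x in nhds (p, p). x \<in> S"
    using oS ppS by (simp add: eventually_nhds_in_open)
  ultimately have "\<forall>\<^sub>F x in nhds (p, p). x \<in> S \<and> (\<forall>i\<in>Basis. norm (f' x (0, i) - i) \<le> \<eta>)"
    by eventually_elim auto
  then obtain d where d: "d > 0" and
    dS: "\<And>x. dist x (p, p) < d \<Longrightarrow> x \<in> S \<and> (\<forall>i\<in>Basis. norm (f' x (0, i) - i) \<le> \<eta>)"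
    unfolding eventually_nhds_metric by blast
  define \<delta> where "\<delta> = d / 2"
  have near: "(a, b) \<in> S" "i \<in> Basis \<Longrightarrow> norm (f' (a, b) (0, i) - i) \<le> \<eta>"
    if "a \<in> ball p \<delta>" "b \<in> ball p \<delta>" for a b i
  proof -
    have "dist (a, b) (p, p) \<le> dist a p + dist b p"
      unfolding dist_Pair_Pair by (rule sqrt_sum_squares_le_sum) auto
    also have "\<dots> < d" using that by (simp add: \<delta>_def dist_commute)
    finally show "(a, b) \<in> S" "i \<in> Basis \<Longrightarrow> norm (f' (a, b) (0, i) - i) \<le> \<eta>" using dS by auto
  qed
  have on: "norm (f' (a, b) (0, v) - v) \<le> 1/2 * norm v" if ab: "a \<in> ball p \<delta>" "b \<in> ball p \<delta>" for a b v
  proof -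
    define L where "L = (\<lambda>v. f' (a, b) (0, v) - v)"
    have "bounded_linear (f' (a, b))" using der near(1)[OF ab] has_derivative_bounded_linear by blast
    then have "bounded_linear (\<lambda>v. f' (a, b) (0, v))"
      by (rule bounded_linear_compose)
        (intro bounded_linear_Pair bounded_linear_zero bounded_linear_ident)
    then have "bounded_linear L" unfolding L_def
      by (intro bounded_linear_sub bounded_linear_ident)
    then have lin: "linear L" by (rule bounded_linear.linear)
    have "L v = L (\<Sum>i\<in>Basis. (v \<bullet> i) *\<^sub>R i)" by (simp add: euclidean_representation)
    also have "\<dots> = (\<Sum>i\<in>Basis. (v \<bullet> i) *\<^sub>R L i)"
      by (simp add: linear_sum[OF lin] linear_scale[OF lin])
    also have "norm \<dots> \<le> (\<Sum>i\<in>(Basis::'e set). norm v * \<eta>)"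
    proof (rule sum_norm_le)
      fix i :: 'e assume i: "i \<in> Basis"
      show "norm ((v \<bullet> i) *\<^sub>R L i) \<le> norm v * \<eta>"
        using near(2)[OF ab i] Basis_le_norm[OF i, of v]
        by (simp add: L_def) (intro mult_mono, auto)
    qed
    also have "\<dots> = 1/2 * norm v" by (simp add: \<eta>_def)
    finally show ?thesis by (simp add: L_def)
  qed
  have sub: "ball p \<delta> \<subseteq> Q"
    using near(1)[of _ p] d by (auto simp: S_def Q_def \<delta>_def)
  \<comment> \<open>Mean value inequality for \<open>b \<mapsto> m (a, b) - b\<close> between
    \<open>p\<close> and \<open>b\<close>, where \<open>m (a, p) = a\<close>.\<close>
  have est: "norm (m (a, b) - a - (b - p)) \<le> norm (b - p) / 2" if a: "a \<in> ball p \<delta>" and b: "b \<in> ball p \<delta>" for a b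
  proof -
    have "norm ((m (a, b) - b) - (m (a, p) - p)) \<le> 1/2 * norm (b - p)"
    proof (rule differentiable_bound[where S="ball p \<delta>" and f'="\<lambda>b v. f' (a, b) (0, v) - v"])
      fix x assume x: "x \<in> ball p \<delta>"
      have "((\<lambda>b. m (a, b)) has_derivative (\<lambda>v. f' (a, x) (0, v))) (at x within ball p \<delta>)"
        by (rule has_derivative_compose[where f="\<lambda>b. (a, b)" and g=m])
          (auto intro!: derivative_eq_intros der near(1) a x)
      then show "((\<lambda>b. m (a, b) - b) has_derivative (\<lambda>v. f' (a, x) (0, v) - v)) (at x within ball p \<delta>)"
        by (intro derivative_intros)
      show "onorm (\<lambda>v. f' (a, x) (0, v) - v) \<le> 1/2"
        by (rule onorm_le) (rule on[OF a x])
    qed (use b d in \<open>auto simp: \<delta>_def\<close>)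
    then show ?thesis using map(1)[of a] a sub by (auto simp: algebra_simps)
  qed
  show ?thesis
  proof (rule that[of W \<phi> \<psi> \<delta>])
    show "\<psi> a + \<psi> b \<in> W" if "a \<in> ball (\<phi> 0) \<delta>" "b \<in> ball (\<phi> 0) \<delta>" for a b
      using near(1)[of a b] that by (auto simp: S_def p_def)
    show "norm (\<phi> (\<psi> a + \<psi> b) - a - (b - \<phi> 0)) \<le> norm (b - \<phi> 0) / 2"
      if "a \<in> ball (\<phi> 0) \<delta>" "b \<in> ball (\<phi> 0) \<delta>" for a b
      using est[of a b] that by (auto simp: m_def p_def)
  qed (use oW W0 oQ hom d sub in \<open>auto simp: Q_def p_def \<delta>_def\<close>)
qed

text \<open>Near the identity \<open>x \<mapsto> nmul n x\<close> is within \<open>n * norm x / 2\<close> of multiplication by \<open>n\<close>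
  in the chart, so Brouwer's theorem on a ball of radius proportional to \<open>1 / n\<close> yields
  \<open>n\<close>-th roots.\<close>
lemma lie_group_small_divisible_nhd:
  assumes lie: "lie_group TYPE('e::euclidean_space) TYPE('g::{group_add,topological_space})"
  shows "\<exists>B. open B \<and> 0 \<in> B \<and> B \<subseteq> (small_divisible :: 'g set)"
proof -
  have tg: "topological_group TYPE('g)" using lie by (simp add: lie_group_def)
  from lie consider "\<forall>x::'g. open {x}" | A :: "('g set \<times> ('g \<Rightarrow> 'e)) set" where "lie_atlas A"
    unfolding lie_group_def by blast
  then show ?thesis
  proof cases
    case 1
    then show ?thesis using zero_small_divisible by (intro exI[of _ "{0}"]) auto
  next
    case 2
    obtain W and \<phi> :: "'g \<Rightarrow> 'e" and \<psi> \<delta> where oW: "open W" and W0: "0 \<in> W" and oQ: "open (\<phi> ` W)"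
      and hom: "homeomorphism W (\<phi> ` W) \<phi> \<psi>" and \<delta>: "\<delta> > 0" and sub: "ball (\<phi> 0) \<delta> \<subseteq> \<phi> ` W"
      and clo: "\<And>a b. a \<in> ball (\<phi> 0) \<delta> \<Longrightarrow> b \<in> ball (\<phi> 0) \<delta> \<Longrightarrow> \<psi> a + \<psi> b \<in> W"
      and est: "\<And>a b. a \<in> ball (\<phi> 0) \<delta> \<Longrightarrow> b \<in> ball (\<phi> 0) \<delta> \<Longrightarrow>
         norm (\<phi> (\<psi> a + \<psi> b) - a - (b - \<phi> 0)) \<le> norm (b - \<phi> 0) / 2"
      using lie_atlas_chart_estimate[OF 2 tg] by metis
    define p where "p = \<phi> 0"
    \<comment> \<open>Iterates obeying the bound in \<open>pow\<close> stay within
      \<open>3 * \<rho> / 2 < \<delta>\<close> of \<open>p\<close>, so \<open>est\<close> keeps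
      applying to them.\<close>
    define \<rho> where "\<rho> = \<delta> / 2"
    have \<rho>: "\<rho> > 0" using \<delta> by (simp add: \<rho>_def)
    have \<psi>p: "\<psi> p = 0" using homeomorphism_apply1[OF hom W0] by (simp add: p_def)
    have pow: "nmul k (\<psi> x) \<in> W \<and> norm (\<phi> (nmul k (\<psi> x)) - p - real k *\<^sub>R (x - p)) \<le> real k * norm (x - p) / 2"
      if "real k * norm (x - p) \<le> \<rho>" "x \<in> ball p \<delta>" for k x
      using that(1)
    proof (induction k)
      case 0
      then show ?case using W0 by (simp add: p_def)
    next
      case (Suc k)
      define a where "a = \<phi> (nmul k (\<psi> x))"
      have le: "real k * norm (x - p) \<le> \<rho>"
        using Suc.prems by (simp add: algebra_simps) (smt (verit) norm_ge_zero)
      then have W: "nmul k (\<psi> x) \<in> W"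
        and n: "norm (a - p - real k *\<^sub>R (x - p)) \<le> real k * norm (x - p) / 2"
        using Suc.IH by (auto simp: a_def)
      have "norm (a - p) \<le> norm (a - p - real k *\<^sub>R (x - p)) + norm (real k *\<^sub>R (x - p))"
        using norm_triangle_ineq[of "a - p - real k *\<^sub>R (x - p)" "real k *\<^sub>R (x - p)"] by simp
      also have "\<dots> \<le> \<rho> / 2 + \<rho>" using n le by simp
      also have "\<dots> < \<delta>" using \<delta> by (simp add: \<rho>_def)
      finally have a: "a \<in> ball p \<delta>" by (simp add: dist_norm norm_minus_commute)
      have \<psi>a: "\<psi> a = nmul k (\<psi> x)" using homeomorphism_apply1[OF hom W] by (simp add: a_def)
      have S: "nmul (Suc k) (\<psi> x) = \<psi> a + \<psi> x" by (simp add: \<psi>a nmul_commute)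
      have "norm (\<phi> (\<psi> a + \<psi> x) - p - real (Suc k) *\<^sub>R (x - p)) \<le>
         norm (\<phi> (\<psi> a + \<psi> x) - a - (x - p)) + norm (a - p - real k *\<^sub>R (x - p))"
        by (rule order_trans[OF _ norm_triangle_ineq]) (simp add: algebra_simps)
      also have "\<dots> \<le> norm (x - p) / 2 + real k * norm (x - p) / 2"
        using est[of a x] a that(2) n by (simp add: p_def)
      also have "\<dots> = real (Suc k) * norm (x - p) / 2" by (simp add: field_simps)
      finally show ?case using clo[of a x] a that(2) S by (simp add: p_def)
    qed
    have root: "\<exists>x\<in>cball p (\<rho> / real n). nmul n (\<psi> x) = \<psi> y" if y: "y \<in> ball p (\<rho> / 2)" and n: "n > 0" for y n
    proof -
      define C where "C = cball p (\<rho> / real n)"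
      have Cn: "real n * norm (x - p) \<le> \<rho>" if "x \<in> C" for x
        using that n by (simp add: C_def dist_norm norm_minus_commute field_simps)
      have "\<rho> / real n \<le> \<rho> / 1" using n \<rho> by (intro divide_left_mono) auto
      then have Cb: "C \<subseteq> ball p \<delta>" using \<delta> by (auto simp: C_def \<rho>_def)
      \<comment> \<open>A Newton step with \<open>n\<close> times the identity as approximate
        derivative; its fixed points solve \<open>\<phi> (nmul n (\<psi> x)) = y\<close>.\<close>
      define g where "g x = x - (\<phi> (nmul n (\<psi> x)) - y) /\<^sub>R real n" for x
      obtain x where x: "x \<in> C" "g x = x"
      proof (rule brouwer[of C g])
        show "compact C" "convex C" "C \<noteq> {}" using \<rho> by (auto simp: C_def divide_less_0_iff)
        have "continuous_on C \<psi>"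
          using homeomorphism_cont2[OF hom] continuous_on_subset Cb sub p_def by (metis order_trans)
        then have "continuous_on C (\<lambda>x. \<phi> (nmul n (\<psi> x)))"
          using pow Cn Cb
          by (intro continuous_on_compose2[OF homeomorphism_cont1[OF hom]] continuous_on_nmul tg) auto
        then show "continuous_on C g" unfolding g_def by (intro continuous_intros)
        show "g \<in> C \<rightarrow> C"
        proof
          fix x assume x: "x \<in> C"
          define q where "q = \<phi> (nmul n (\<psi> x))"
          have "norm (q - p - real n *\<^sub>R (x - p)) \<le> real n * norm (x - p) / 2"
            using pow[OF Cn[OF x]] Cb x by (auto simp: q_def)
          also have "\<dots> \<le> \<rho> / 2" using Cn[OF x] by simp
          finally have 1: "norm (q - p - real n *\<^sub>R (x - p)) \<le> \<rho> / 2" .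
          have "g x - p = ((y - p) - (q - p - real n *\<^sub>R (x - p))) /\<^sub>R real n"
            using n by (simp add: g_def q_def algebra_simps)
          then have "norm (g x - p) = norm ((y - p) - (q - p - real n *\<^sub>R (x - p))) / real n"
            by (simp add: divide_inverse mult.commute)
          also have "\<dots> \<le> (\<rho> / 2 + \<rho> / 2) / real n"
            using norm_triangle_ineq4[of "y - p" "q - p - real n *\<^sub>R (x - p)"] 1 y
            by (intro divide_right_mono) (auto simp: dist_norm norm_minus_commute)
          finally show "g x \<in> C" by (simp add: C_def dist_norm norm_minus_commute)
        qed
      qed
      from x(2) have "\<phi> (nmul n (\<psi> x)) = y" using n by (simp add: g_def)
      moreover have "nmul n (\<psi> x) \<in> W" using pow[OF Cn[OF x(1)]] Cb x(1) by auto
      ultimately have "nmul n (\<psi> x) = \<psi> y" using homeomorphism_apply1[OF hom] by metis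
      then show ?thesis using x(1) by (auto simp: C_def)
    qed
    define B where "B = W \<inter> \<phi> -` ball p (\<rho> / 2)"
    have "open B" unfolding B_def
      by (intro continuous_open_preimage homeomorphism_cont1[OF hom] oW open_ball)
    moreover have "0 \<in> B" using W0 \<rho> by (simp add: B_def p_def)
    moreover have "B \<subseteq> small_divisible"
    proof
      fix b assume "b \<in> B"
      then have b: "b \<in> W" "\<phi> b \<in> ball p (\<rho> / 2)" by (auto simp: B_def)
      show "b \<in> small_divisible"
        unfolding small_divisible_def
      proof (intro CollectI allI impI)
        fix V :: "'g set" assume V: "open V" "0 \<in> V"
        have "open (\<phi> ` W \<inter> \<psi> -` V)"
          by (intro continuous_open_preimage homeomorphism_cont2[OF hom] oQ V)
        moreover have "p \<in> \<phi> ` W \<inter> \<psi> -` V" using V W0 \<psi>p by (auto simp: p_def)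
        ultimately obtain e where e: "e > 0" "ball p e \<subseteq> \<phi> ` W \<inter> \<psi> -` V"
          by (meson openE)
        \<comment> \<open>The roots lie in balls of radius \<open>\<rho> / n\<close>, which
          eventually fit into the chart image of \<open>V\<close>.\<close>
        have "(\<lambda>n. \<rho> / real n) \<longlonglongrightarrow> 0" by (rule lim_const_over_n)
        then have "\<forall>\<^sub>F n in sequentially. \<rho> / real n < e"
          using e(1) by (rule order_tendstoD)
        then show "\<forall>\<^sub>F n in sequentially. \<exists>h\<in>V. nmul n h = b"
          using eventually_gt_at_top[of 0]
        proof eventually_elim
          case (elim n)
          obtain x where x: "x \<in> cball p (\<rho> / real n)" "nmul n (\<psi> x) = \<psi> (\<phi> b)"
            using root[OF b(2) elim(2)] by blast
          then have "x \<in> ball p e" using elim by auto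
          then show ?case using e(2) x(2) homeomorphism_apply1[OF hom b(1)] by auto
        qed
      qed
    qed
    ultimately show ?thesis by blast
  qed
qed

section \<open>Commutators in a nilpotent group\<close>

definition comm :: "'g::group_add \<Rightarrow> 'g \<Rightarrow> 'g" where
  "comm a b = a + b + - a + - b"

lemmas group_word = minus_add add.assoc diff_conv_add_uminus

lemma comm_zero_left [simp]: "comm 0 b = 0" and comm_zero_right [simp]: "comm a 0 = 0"
  and comm_self [simp]: "comm a a = 0"
  by (simp_all add: comm_def add.assoc del: add_uminus_conv_diff)

lemma comm_swap: "comm b a = - comm a b"
  by (simp add: comm_def group_word del: add_uminus_conv_diff)

lemma comm_add_left: "comm (a + a') b = (a + comm a' b + - a) + comm a b"
  by (simp add: comm_def group_word del: add_uminus_conv_diff)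

lemma comm_add_right: "comm a (b + b') = comm a b + (b + comm a b' + - b)"
  by (simp add: comm_def group_word del: add_uminus_conv_diff)

lemma comm_conj: "g + comm a b + - g = comm (g + a + - g) (g + b + - g)"
  by (simp add: comm_def group_word del: add_uminus_conv_diff)

lemma subgroup_of_zero: "subgroup_of A \<Longrightarrow> 0 \<in> A"
  and subgroup_of_add: "subgroup_of A \<Longrightarrow> x \<in> A \<Longrightarrow> y \<in> A \<Longrightarrow> x + y \<in> A"
  and subgroup_of_minus: "subgroup_of A \<Longrightarrow> x \<in> A \<Longrightarrow> - x \<in> A"
  by (auto simp: subgroup_of_def)

lemma subgroup_of_nmul: "subgroup_of A \<Longrightarrow> x \<in> A \<Longrightarrow> nmul n x \<in> A"
  by (induction n) (auto simp: subgroup_of_def)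

lemma subgroup_of_gen_subgroup: "subgroup_of (gen_subgroup S)"
  by (auto simp: subgroup_of_def intro: gen_subgroup.intros)

lemma subgroup_of_Int: "subgroup_of A \<Longrightarrow> subgroup_of B \<Longrightarrow> subgroup_of (A \<inter> B)"
  by (auto simp: subgroup_of_def)

lemma gen_subgroup_subset:
  assumes "subgroup_of A" "S \<subseteq> A"
  shows "gen_subgroup S \<subseteq> A"
proof
  fix x assume "x \<in> gen_subgroup S"
  then show "x \<in> A"
    by induction (use assms in \<open>auto simp: subgroup_of_def\<close>)
qed

lemma gen_subgroup_conj:
  fixes g :: "'g::group_add"
  assumes "\<And>x. x \<in> S \<Longrightarrow> g + x + - g \<in> gen_subgroup S" and "x \<in> gen_subgroup S"
  shows "g + x + - g \<in> gen_subgroup S"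
  using assms(2)
proof induction
  case (add x y)
  have "g + (x + y) + - g = (g + x + - g) + (g + y + - g)"
    by (simp add: group_word del: add_uminus_conv_diff)
  then show ?case using add gen_subgroup.add by metis
next
  case (inv x)
  have "g + - x + - g = - (g + x + - g)"
    by (simp add: group_word del: add_uminus_conv_diff)
  then show ?case using inv gen_subgroup.inv by metis
next
  case (base x)
  then show ?case by (rule assms(1))
qed (simp add: gen_subgroup.zero)

text \<open>\<open>low\<close> differs from the lower central series of \<open>H\<close> only at index \<open>0\<close>, where \<open>H\<close> is
  replaced by its normal subgroup generated by \<open>D\<close>, whose elements are divisible. Indices are
  shifted by one as in \<open>lcs\<close>.\<close>
locale commutator_filtration =
  fixes D :: "'g::group_add set" and \<tau> :: 'g
  assumes conj_D: "\<And>g x. x \<in> D \<Longrightarrow> g + x + - g \<in> D"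
begin

definition H :: "'g set" where "H = gen_subgroup (insert \<tau> D)"

primrec low :: "nat \<Rightarrow> 'g set" where
  "low 0 = gen_subgroup D"
| "low (Suc k) = gen_subgroup {comm a b | a b. a \<in> H \<and> b \<in> low k}"

text \<open>Congruence modulo \<open>low k\<close>. Since \<open>H\<close> normalizes
  \<open>low k\<close>, it respects sums and inverses as long as the relevant elements lie in
  \<open>H\<close>.\<close>

definition eqv :: "nat \<Rightarrow> 'g \<Rightarrow> 'g \<Rightarrow> bool" where
  "eqv k x y \<longleftrightarrow> - x + y \<in> low k"

lemma subgroup_H: "subgroup_of H"
  by (simp add: H_def subgroup_of_gen_subgroup)

lemma subgroup_low: "subgroup_of (low k)"
  by (cases k) (simp_all add: subgroup_of_gen_subgroup)

lemmas H_closed = subgroup_of_zero[OF subgroup_H] subgroup_of_add[OF subgroup_H]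
  subgroup_of_minus[OF subgroup_H] subgroup_of_nmul[OF subgroup_H]

lemmas low_closed = subgroup_of_zero[OF subgroup_low] subgroup_of_add[OF subgroup_low]
  subgroup_of_minus[OF subgroup_low] subgroup_of_nmul[OF subgroup_low]

lemma tau_H: "\<tau> \<in> H" and D_H: "x \<in> D \<Longrightarrow> x \<in> H"
  by (auto simp: H_def intro: gen_subgroup.base)

lemma comm_low: "a \<in> H \<Longrightarrow> b \<in> low k \<Longrightarrow> comm a b \<in> low (Suc k)"
  by (auto intro: gen_subgroup.base)

lemma conj_low: "g \<in> H \<Longrightarrow> x \<in> low k \<Longrightarrow> g + x + - g \<in> low k"
proof (induction k arbitrary: x)
  case 0
  show ?case
    using gen_subgroup_conj[of D g x] 0 conj_D gen_subgroup.base by auto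
next
  case (Suc k)
  have "g + y + - g \<in> low (Suc k)" if "y \<in> {comm a b | a b. a \<in> H \<and> b \<in> low k}" for y
  proof -
    from that obtain a b where y: "y = comm a b" and a: "a \<in> H" and b: "b \<in> low k" by blast
    have "g + a + - g \<in> H" using a Suc.prems(1) by (intro H_closed)
    then show ?thesis
      unfolding y comm_conj using Suc.IH[OF Suc.prems(1) b] by (rule comm_low)
  qed
  then show ?case
    using gen_subgroup_conj[of "{comm a b | a b. a \<in> H \<and> b \<in> low k}" g x] Suc.prems by simp
qed

lemma conj_low': "g \<in> H \<Longrightarrow> x \<in> low k \<Longrightarrow> - g + x + g \<in> low k"
  using conj_low[of "- g" x k] H_closed(3) by simp

lemma low_Suc_subset: "low (Suc k) \<subseteq> low k"
proof -
  have "comm a b \<in> low k" if "a \<in> H" "b \<in> low k" for a b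
  proof -
    have "comm a b = (a + b + - a) + - b" by (simp add: comm_def)
    also have "\<dots> \<in> low k" using that by (intro low_closed(2) conj_low low_closed(3))
    finally show ?thesis .
  qed
  then show ?thesis unfolding low.simps(2) by (intro gen_subgroup_subset[OF subgroup_low]) auto
qed

lemma low_H: "x \<in> low k \<Longrightarrow> x \<in> H"
proof -
  have "low k \<subseteq> H"
  proof (induction k)
    case 0
    show ?case unfolding low.simps(1) using D_H by (intro gen_subgroup_subset[OF subgroup_H]) auto
  next
    case (Suc k)
    then show ?case using low_Suc_subset by blast
  qed
  then show "x \<in> low k \<Longrightarrow> x \<in> H" by blast
qed

text \<open>Through this inclusion, nilpotency of the whole group makes \<open>low s\<close>
  trivial.\<close>

lemma low_subset_lcs: "low k \<subseteq> lcs k"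
proof (induction k)
  case (Suc k)
  have "subgroup_of (lcs (Suc k) :: 'g set)" by (simp add: subgroup_of_gen_subgroup)
  moreover have "{comm a b | a b. a \<in> H \<and> b \<in> low k} \<subseteq> lcs (Suc k)"
    using Suc by (auto simp: comm_def simp del: add_uminus_conv_diff intro!: gen_subgroup.base)
  ultimately show ?case unfolding low.simps by (rule gen_subgroup_subset)
qed simp

lemma eqv_refl [simp]: "eqv k x x"
  by (simp add: eqv_def low_closed)

lemma eqv_sym: "eqv k x y \<Longrightarrow> eqv k y x"
  unfolding eqv_def using low_closed(3)[of "- x + y" k] by (simp add: group_word del: add_uminus_conv_diff)

lemma eqv_trans [trans]: "eqv k x y \<Longrightarrow> eqv k y z \<Longrightarrow> eqv k x z"
  unfolding eqv_def using low_closed(2)[of "- x + y" k "- y + z"]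
  by (simp add: group_word del: add_uminus_conv_diff)

lemma eqv_mono: "eqv (Suc k) x y \<Longrightarrow> eqv k x y"
  unfolding eqv_def using low_Suc_subset by blast

lemma eqv_add: "eqv k x x' \<Longrightarrow> eqv k y y' \<Longrightarrow> y \<in> H \<Longrightarrow> eqv k (x + y) (x' + y')"
  unfolding eqv_def using low_closed(2)[OF conj_low'[of y "- x + x'" k], of "- y + y'"]
  by (simp add: group_word del: add_uminus_conv_diff)

lemma eqv_minus: "eqv k x y \<Longrightarrow> x \<in> H \<Longrightarrow> eqv k (- x) (- y)"
  unfolding eqv_def using conj_low[OF _ low_closed(3), of x "- x + y" k]
  by (simp add: group_word del: add_uminus_conv_diff)

lemma eqv_add_left: "eqv k y y' \<Longrightarrow> eqv k (x + y) (x + y')"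
  by (simp add: eqv_def group_word del: add_uminus_conv_diff)

lemma eqv_add_right: "eqv k x x' \<Longrightarrow> y \<in> H \<Longrightarrow> eqv k (x + y) (x' + y)"
  by (rule eqv_add) auto

lemma eqv_low: "eqv k x y \<Longrightarrow> x \<in> low k \<Longrightarrow> y \<in> low k"
  unfolding eqv_def using low_closed(2)[of x k "- x + y"] by simp

lemma eqv_H: "eqv k x y \<Longrightarrow> x \<in> H \<Longrightarrow> y \<in> H"
  unfolding eqv_def using H_closed(2)[of x "- x + y"] low_H by simp

text \<open>The commutator exchanging \<open>a\<close> and \<open>b\<close> lies in
  \<open>low (Suc k)\<close>: modulo the next term, \<open>low k\<close> is central in
  \<open>H\<close>.\<close>

lemma eqv_commute: "a \<in> H \<Longrightarrow> b \<in> low k \<Longrightarrow> eqv (Suc k) (a + b) (b + a)"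
  unfolding eqv_def
  using low_closed(3)[OF comm_low[of "- a" "- b" k]] H_closed(3)[of a] low_closed(3)[of b k]
  by (simp add: comm_def group_word del: add_uminus_conv_diff low.simps)

lemma eqv_conj:
  assumes "a \<in> H" "b \<in> low k"
  shows "eqv (Suc k) (a + b + - a) b"
  using eqv_add_right[OF eqv_commute[OF assms], of "- a"] assms(1)
  by (simp add: H_closed group_word del: add_uminus_conv_diff)

lemma eqv_cancel: "eqv k (x + y) 0 \<Longrightarrow> eqv k y (- x)"
  using eqv_add_left[of k "x + y" 0 "- x"] by simp

text \<open>Conjugation by \<open>H\<close> acts trivially on \<open>low (Suc k)\<close> modulo
  \<open>low (Suc (Suc k))\<close>, so the conjugation in \<open>comm_add_left\<close> disappears.
  With the lemmas that follow, \<open>comm\<close> becomes biadditive modulo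
  \<open>low (Suc (Suc k))\<close>.\<close>

lemma comm_add_left_eqv:
  assumes "a \<in> H" "a' \<in> H" "b \<in> low k"
  shows "eqv (Suc (Suc k)) (comm (a + a') b) (comm a b + comm a' b)"
proof -
  have c: "comm a b \<in> low (Suc k)" "comm a' b \<in> low (Suc k)" using assms comm_low by auto
  have "eqv (Suc (Suc k)) (comm (a + a') b) (comm a' b + comm a b)"
    unfolding comm_add_left using assms c low_H by (intro eqv_add_right eqv_conj)
  also have "eqv (Suc (Suc k)) (comm a' b + comm a b) (comm a b + comm a' b)"
    using c low_H by (intro eqv_commute)
  finally show ?thesis .
qed

lemma comm_add_right_eqv:
  assumes "a \<in> H" "b \<in> low k" "b' \<in> low k"
  shows "eqv (Suc (Suc k)) (comm a (b + b')) (comm a b + comm a b')"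
  unfolding comm_add_right using assms comm_low low_H by (intro eqv_add_left eqv_conj)

text \<open>The change \<open>l\<close> of the second entry contributes only a conjugate of
  \<open>comm a l\<close>, which lies in \<open>low (Suc (Suc k))\<close>.\<close>

lemma comm_eqv_right:
  assumes a: "a \<in> H" and b: "b \<in> low k" and e: "eqv (Suc k) b b'"
  shows "eqv (Suc (Suc k)) (comm a b) (comm a b')"
proof -
  define l where "l = - b + b'"
  have l: "l \<in> low (Suc k)" using e by (simp add: eqv_def l_def)
  have "b' = b + l" by (simp add: l_def)
  then have "- comm a b + comm a b' = b + comm a l + - b"
    by (simp add: comm_add_right group_word del: add_uminus_conv_diff)
  then show ?thesis
    unfolding eqv_def using conj_low[OF low_H[OF b] comm_low[OF a l]] by simp
qed

lemma comm_minus_left_eqv: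
  assumes "a \<in> H" "b \<in> low k"
  shows "eqv (Suc (Suc k)) (comm (- a) b) (- comm a b)"
  using comm_add_left_eqv[of a "- a" b k] assms H_closed(3) by (intro eqv_cancel[OF eqv_sym]) simp

lemma comm_minus_right_eqv:
  assumes "a \<in> H" "b \<in> low k"
  shows "eqv (Suc (Suc k)) (comm a (- b)) (- comm a b)"
  using comm_add_right_eqv[of a b k "- b"] assms low_closed(3) by (intro eqv_cancel[OF eqv_sym]) simp

lemma comm_nmul_left_eqv:
  assumes "a \<in> H" "b \<in> low k"
  shows "eqv (Suc (Suc k)) (comm (nmul n a) b) (nmul n (comm a b))"
proof (induction n)
  case (Suc n)
  have "eqv (Suc (Suc k)) (comm (a + nmul n a) b) (comm a b + comm (nmul n a) b)"
    using assms by (intro comm_add_left_eqv H_closed)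
  also have "eqv (Suc (Suc k)) (comm a b + comm (nmul n a) b) (comm a b + nmul n (comm a b))"
    by (intro eqv_add_left Suc.IH)
  finally show ?case by simp
qed simp

lemma comm_nmul_right_eqv:
  assumes "a \<in> H" "b \<in> low k"
  shows "eqv (Suc (Suc k)) (comm a (nmul n b)) (nmul n (comm a b))"
proof (induction n)
  case (Suc n)
  have "eqv (Suc (Suc k)) (comm a (b + nmul n b)) (comm a b + comm a (nmul n b))"
    using assms by (intro comm_add_right_eqv low_closed)
  also have "eqv (Suc (Suc k)) (comm a b + comm a (nmul n b)) (comm a b + nmul n (comm a b))"
    by (intro eqv_add_left Suc.IH)
  finally show ?case by simp
qed simp

lemma nmul_add_eqv:
  assumes "x \<in> low k" "y \<in> low k"
  shows "eqv (Suc k) (nmul n (x + y)) (nmul n x + nmul n y)"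
proof (induction n)
  case (Suc n)
  have "eqv (Suc k) (x + y + nmul n (x + y)) (x + y + (nmul n x + nmul n y))"
    by (intro eqv_add_left Suc.IH)
  also have "x + y + (nmul n x + nmul n y) = x + ((y + nmul n x) + nmul n y)"
    by (simp add: add.assoc)
  also have "eqv (Suc k) \<dots> (x + ((nmul n x + y) + nmul n y))"
    using assms low_H[OF low_closed(4)] low_H low_closed(4) by (intro eqv_add_left eqv_add_right eqv_commute) auto
  finally show ?case by (simp add: add.assoc)
qed simp

text \<open>The generators of \<open>low 1\<close> have one entry in \<open>low 0\<close>, yet
  \<open>low 1\<close> contains all commutators of \<open>H\<close>: modulo \<open>low 0\<close> the
  group \<open>H\<close> is generated by the single element \<tau>, and
  \<open>comm \<tau> \<tau> = 0\<close>.\<close>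

lemma comm_low_1:
  assumes "x \<in> H" "y \<in> H"
  shows "comm x y \<in> low 1"
proof -
  have cadd: "comm (a + a') b \<in> low 1" if "comm a b \<in> low 1" "comm a' b \<in> low 1" "a \<in> H" for a a' b
    unfolding comm_add_left using that by (intro low_closed conj_low)
  have cinv: "comm (- a) b \<in> low 1" if "comm a b \<in> low 1" "a \<in> H" for a b
  proof -
    have "comm (- a) b = - a + - comm a b + a"
      by (simp add: comm_def group_word del: add_uminus_conv_diff)
    then show ?thesis using conj_low'[OF that(2) low_closed(3)[OF that(1)]] by metis
  qed
  have D: "comm x y \<in> low 1" if "x \<in> H" "y \<in> D" for x y
    using comm_low[OF that(1), of y 0] that(2) by (auto intro: gen_subgroup.base)
  \<comment> \<open>For fixed \<open>y\<close> the condition passes to sums and inverses in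
    \<open>x\<close>, so it is tested on generators. It is used first with \<open>y = \<tau>\<close>
    and then, after swapping the entries, with general \<open>y\<close>.\<close>
  have gen: "comm x y \<in> low 1"
    if y: "comm \<tau> y \<in> low 1" "\<And>d. d \<in> D \<Longrightarrow> comm d y \<in> low 1" and "x \<in> H" for x y
    using that(3) unfolding H_def
  proof induction
    case zero
    then show ?case by (simp only: comm_zero_left low_closed)
  next
    case (add x x')
    then show ?case using cadd[of x y x'] by (simp add: H_def)
  next
    case (inv x)
    then show ?case using cinv[of x y] by (simp add: H_def)
  qed (use y in auto)
  have "comm x \<tau> \<in> low 1" if "x \<in> H" for x
  proof (rule gen)
    show "comm \<tau> \<tau> \<in> low 1" by (simp only: comm_self low_closed)
    show "comm d \<tau> \<in> low 1" if "d \<in> D" for d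
      using low_closed(3)[OF D[OF tau_H that]] comm_swap by metis
  qed (use that in auto)
  then have "comm \<tau> y \<in> low 1" using low_closed(3)[of "comm y \<tau>" 1] assms(2) comm_swap by metis
  moreover have "comm d y \<in> low 1" if "d \<in> D" for d
    using low_closed(3)[OF D[OF assms(2) that]] comm_swap by metis
  ultimately show ?thesis using gen assms(1) by blast
qed

lemma eqv_commute_1:
  assumes "x \<in> H" "y \<in> H"
  shows "eqv 1 (x + y) (y + x)"
proof -
  have "- (x + y) + (y + x) = comm (- y) (- x)"
    by (simp add: comm_def group_word del: add_uminus_conv_diff)
  then show ?thesis unfolding eqv_def using comm_low_1 H_closed(3) assms by metis
qed

text \<open>The nested commutator [g1, [g2, ..., [gr, x]]]: the last entry of the list is the
  innermost one, so appending an entry replaces \<open>x\<close> by a commutator.\<close>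

definition itcomm :: "'g list \<Rightarrow> 'g \<Rightarrow> 'g" where
  "itcomm gs x = foldr comm gs x"

lemma itcomm_simps [simp]:
  "itcomm [] x = x" "itcomm (g # gs) x = comm g (itcomm gs x)"
  "itcomm (gs @ [g]) x = itcomm gs (comm g x)"
  by (simp_all add: itcomm_def)

lemma itcomm_zero [simp]: "itcomm gs 0 = 0"
  by (induction gs) auto

lemma itcomm_low: "set gs \<subseteq> H \<Longrightarrow> x \<in> low k \<Longrightarrow> itcomm gs x \<in> low (k + length gs)"
  by (induction gs) (auto simp del: low.simps intro: comm_low)

lemma itcomm_eqv:
  assumes "set gs \<subseteq> H" "x \<in> low k" "eqv (Suc k) x y"
  shows "eqv (Suc (k + length gs)) (itcomm gs x) (itcomm gs y)"
  using assms(1)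
proof (induction gs)
  case (Cons g gs)
  then show ?case
    using comm_eqv_right[of g "itcomm gs x" "k + length gs"] itcomm_low[of gs x k] assms(2) by auto
qed (use assms in auto)

lemma itcomm_add_eqv:
  assumes "set gs \<subseteq> H" "x \<in> low k" "y \<in> low k"
  shows "eqv (Suc (k + length gs)) (itcomm gs (x + y)) (itcomm gs x + itcomm gs y)"
  using assms(1)
proof (induction gs)
  case (Cons g gs)
  let ?m = "k + length gs"
  have l: "itcomm gs x \<in> low ?m" "itcomm gs y \<in> low ?m" "itcomm gs (x + y) \<in> low ?m"
    using Cons.prems assms(2,3) by (auto intro!: itcomm_low low_closed)
  have "eqv (Suc (Suc ?m)) (comm g (itcomm gs (x + y))) (comm g (itcomm gs x + itcomm gs y))"
    using Cons l by (intro comm_eqv_right) auto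
  also have "eqv (Suc (Suc ?m)) (comm g (itcomm gs x + itcomm gs y))
      (comm g (itcomm gs x) + comm g (itcomm gs y))"
    using Cons.prems l by (intro comm_add_right_eqv) auto
  finally show ?case by simp
qed simp

end

section \<open>Minimal translations of nilmanifolds\<close>

text \<open>The properties of a minimal nilsystem on which the argument rests.
  \<open>cocompact\<close> is compactness of the quotient written in the group, where finitely many
  members of a cover reach everything after right translation by \<Gamma>;
  \<open>dense_orbit\<close> is density of all forward orbits in the quotient.\<close>

locale nilrotation =
  fixes \<Gamma> :: "'g::{group_add,topological_space} set" and \<tau> :: 'g and s :: nat
  assumes tg: "topological_group TYPE('g)"
    and subgroup_\<Gamma>: "subgroup_of \<Gamma>"
    and nilpotent: "lcs s = ({0} :: 'g set)"
    and cocompact: "\<And>\<O>. (\<And>U. U \<in> \<O> \<Longrightarrow> open U) \<Longrightarrow> \<Union>\<O> = UNIV \<Longrightarrow>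
       \<exists>\<F>. finite \<F> \<and> \<F> \<subseteq> \<O> \<and> (\<forall>x. \<exists>U\<in>\<F>. \<exists>u\<in>U. \<exists>\<gamma>\<in>\<Gamma>. x = u + \<gamma>)"
    and dense_orbit: "\<And>x U. open U \<Longrightarrow> U \<noteq> {} \<Longrightarrow> \<exists>n. \<exists>\<gamma>\<in>\<Gamma>. nmul n \<tau> + x + \<gamma> \<in> U"
    and small_divisible_nhd: "\<exists>B. open B \<and> 0 \<in> B \<and> B \<subseteq> (small_divisible :: 'g set)"
begin

lemmas cont_add = continuous_on_group_add[OF tg]
  and cont_minus = continuous_on_group_minus[OF tg]

lemma cont_comm:
  assumes "continuous_on S f" "continuous_on S g"
  shows "continuous_on S (\<lambda>x. comm (f x) (g x) :: 'g)"
  unfolding comm_def by (intro cont_add cont_minus assms)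

lemmas cont_intros = cont_add cont_minus cont_comm continuous_on_const continuous_on_id
  continuous_on_fst continuous_on_snd

lemma open_translate_left: "open U \<Longrightarrow> open {x :: 'g. a + x \<in> U}"
  using open_vimage[of U "\<lambda>x. a + x"] by (simp add: vimage_def cont_intros)

lemma open_translate_right: "open U \<Longrightarrow> open {x :: 'g. x + a \<in> U}"
  using open_vimage[of U "\<lambda>x. x + a"] by (simp add: vimage_def cont_intros)

lemma conj_small_divisible:
  assumes "x \<in> small_divisible"
  shows "g + x + - g \<in> (small_divisible :: 'g set)"
  unfolding small_divisible_def
proof (intro CollectI allI impI)
  fix V :: "'g set" assume V: "open V" "0 \<in> V"
  define V' where "V' = (\<lambda>h. g + h + - g) -` V"
  have "open V'" unfolding V'_def by (intro open_vimage V cont_intros)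
  moreover have "0 \<in> V'" using V by (simp add: V'_def)
  ultimately have "\<forall>\<^sub>F n in sequentially. \<exists>h\<in>V'. nmul n h = x"
    using assms unfolding small_divisible_def by blast
  then show "\<forall>\<^sub>F n in sequentially. \<exists>h\<in>V. nmul n h = g + x + - g"
  proof eventually_elim
    case (elim n)
    then obtain h where h: "g + h + - g \<in> V" "nmul n h = x" unfolding V'_def by blast
    then show ?case using nmul_conj[of n g h] by metis
  qed
qed

end

sublocale nilrotation \<subseteq> commutator_filtration small_divisible \<tau>
  by unfold_locales (rule conj_small_divisible)

context nilrotation
begin

lemma cont_itcomm:
  assumes "continuous_on S f"
  shows "continuous_on S (\<lambda>x. itcomm gs (f x))"
  by (induction gs) (auto intro: cont_comm assms)

section \<open>Closures, open subgroups and cocompactness\<close>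

lemma mem_closureI:
  assumes "\<And>V. open V \<Longrightarrow> 0 \<in> V \<Longrightarrow> \<exists>v\<in>V. \<exists>a\<in>closure A. x = v + (a :: 'g)"
  shows "x \<in> closure A"
proof (rule ccontr)
  assume x: "x \<notin> closure A"
  define V where "V = {v. - v + x \<in> - closure A}"
  have "open V"
    using open_vimage[of "- closure A" "\<lambda>v. - v + x"]
    by (simp add: V_def vimage_def cont_intros open_Compl)
  moreover have "0 \<in> V" using x by (simp add: V_def)
  ultimately obtain v a where v: "v \<in> V" and a: "a \<in> closure A" "x = v + a" using assms by blast
  then show False by (simp add: V_def)
qed

lemma mem_closureD:
  assumes x: "x \<in> closure A" and V: "open V" "0 \<in> V"
  shows "\<exists>v\<in>V. \<exists>a\<in>A. x = v + (a :: 'g)"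
proof -
  define U where "U = (\<lambda>z. x + - z) -` V"
  have "open U" unfolding U_def by (intro open_vimage V cont_intros)
  moreover have "x \<in> U" using V by (simp add: U_def)
  ultimately have "U \<inter> A \<noteq> {}" using x open_Int_closure_eq_empty[of U A] by blast
  then obtain a where a: "a \<in> A" "x + - a \<in> V" by (auto simp: U_def)
  then show ?thesis by (intro bexI[of _ "x + - a"] bexI[of _ a]) (auto simp: add.assoc)
qed

lemma subgroup_of_closure:
  assumes A: "subgroup_of A"
  shows "subgroup_of (closure (A :: 'g set))"
  unfolding subgroup_of_def
proof (intro conjI ballI)
  show "0 \<in> closure A" using A closure_subset by (auto simp: subgroup_of_def)
  have "(\<lambda>p. fst p + snd p) ` closure (A \<times> A) \<subseteq> closure A"
    using image_closure_subset[of "A \<times> A" "\<lambda>p. fst p + snd p" "closure A"] A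
      continuous_on_subset[of UNIV "\<lambda>p::'g\<times>'g. fst p + snd p"] closure_subset[of A]
    by (fastforce simp: subgroup_of_def cont_intros)
  then show "x + y \<in> closure A" if "x \<in> closure A" "y \<in> closure A" for x y
    using that by (auto simp: closure_Times image_subset_iff)
  have "uminus ` closure A \<subseteq> closure A"
    using image_closure_subset[of A uminus "closure A"] A
      continuous_on_subset[of UNIV "uminus :: 'g \<Rightarrow> 'g"] closure_subset[of A]
    by (fastforce simp: subgroup_of_def cont_intros)
  then show "- x \<in> closure A" if "x \<in> closure A" for x using that by blast
qed

lemma open_subgroup:
  assumes A: "subgroup_of A" and B: "open B" "0 \<in> B" "B \<subseteq> (A :: 'g set)"
  shows "open A"
proof (rule Topological_Spaces.openI)
  fix a assume a: "a \<in> A"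
  have "{x. - a + x \<in> B} \<subseteq> A"
  proof
    fix x assume "x \<in> {x. - a + x \<in> B}"
    then have "a + (- a + x) \<in> A" using subgroup_of_add[OF A a] B by blast
    then show "x \<in> A" by simp
  qed
  then show "\<exists>T. open T \<and> a \<in> T \<and> T \<subseteq> A"
    using open_translate_left[OF B(1)] B(2) by (intro exI[of _ "{x. - a + x \<in> B}"]) auto
qed

lemma open_low_0: "open (low 0)"
proof -
  obtain B where "open B" "0 \<in> B" "B \<subseteq> (small_divisible :: 'g set)" using small_divisible_nhd by blast
  then show ?thesis
    by (intro open_subgroup[OF subgroup_low, of B]) (auto intro: gen_subgroup.base)
qed

lemma open_H: "open H"
  using open_subgroup[OF subgroup_H open_low_0] low_closed(1) low_H by blast

lemma subgroup_\<Gamma>H: "subgroup_of (\<Gamma> \<inter> H)"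
  by (intro subgroup_of_Int subgroup_\<Gamma> subgroup_H)

lemmas \<Gamma>_closed = subgroup_of_zero[OF subgroup_\<Gamma>] subgroup_of_add[OF subgroup_\<Gamma>]
  subgroup_of_minus[OF subgroup_\<Gamma>]

text \<open>\<open>H\<close> is open and contains \<tau>, so an orbit point can be steered into
  \<open>U \<inter> H\<close>, and then the lattice element used lies in \<open>H\<close> as
  well.\<close>

lemma dense_in_H:
  assumes "open U" "g \<in> U" "g \<in> H"
  shows "\<exists>n. \<exists>\<gamma>\<in>\<Gamma> \<inter> H. nmul n \<tau> + \<gamma> \<in> U"
proof -
  have "open (U \<inter> H)" "U \<inter> H \<noteq> {}" using assms open_H by auto
  then obtain n \<gamma> where n: "\<gamma> \<in> \<Gamma>" "nmul n \<tau> + \<gamma> \<in> U" "nmul n \<tau> + \<gamma> \<in> H"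
    using dense_orbit[of "U \<inter> H" 0] by auto
  have "\<gamma> \<in> H" using H_closed(2)[OF H_closed(3)[OF H_closed(4)[OF tau_H]] n(3), of n] by simp
  then show ?thesis using n by auto
qed

text \<open>Cocompactness passes to open subgroups. The group is covered by the saturations of the
  sets \<open>U c \<inter> P\<close> together with the complement \<open>E\<close> of
  \<open>P + \<Gamma>\<close>, and \<open>E\<close> contributes nothing on \<open>P\<close>.\<close>

lemma cocompact_open_subgroup:
  assumes P: "open P" "subgroup_of P"
    and U: "\<And>c. c \<in> P \<Longrightarrow> open (U c) \<and> c \<in> U c"
  shows "\<exists>F. finite F \<and> F \<subseteq> P \<and> (\<forall>x\<in>P. \<exists>c\<in>F. \<exists>u\<in>U c \<inter> P. \<exists>\<gamma>\<in>\<Gamma> \<inter> P. x = u + \<gamma>)"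
proof -
  define E where "E = {x. \<forall>\<gamma>\<in>\<Gamma>. x + \<gamma> \<notin> P}"
  define cover where "cover = insert E ((\<lambda>c. {x. \<exists>\<gamma>\<in>\<Gamma>. x + \<gamma> \<in> U c \<inter> P}) ` P)"
  \<comment> \<open>\<open>E\<close> is a union of cosets \<open>P + x\<close>, and each of them is
    open.\<close>
  have oE: "open E"
  proof (rule Topological_Spaces.openI)
    fix x assume x: "x \<in> E"
    have "{y. y + - x \<in> P} \<subseteq> E"
    proof (intro subsetI CollectI, unfold E_def, intro CollectI ballI notI)
      fix y \<gamma> assume y: "y \<in> {y. y + - x \<in> P}" and \<gamma>: "\<gamma> \<in> \<Gamma>" and "y + \<gamma> \<in> P"
      then have "- (y + - x) + (y + \<gamma>) \<in> P" using P(2) by (auto simp: subgroup_of_def)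
      then have "x + \<gamma> \<in> P" by (simp add: group_word del: add_uminus_conv_diff)
      then show False using x \<gamma> by (simp add: E_def)
    qed
    then show "\<exists>T. open T \<and> x \<in> T \<and> T \<subseteq> E"
      using open_translate_right[OF P(1), of "- x"] P(2)
      by (intro exI[of _ "{y. y + - x \<in> P}"]) (auto simp: subgroup_of_def)
  qed
  have "open V" if "V \<in> cover" for V
  proof (cases "V = E")
    case False
    then obtain c where c: "c \<in> P" "V = {x. \<exists>\<gamma>\<in>\<Gamma>. x + \<gamma> \<in> U c \<inter> P}"
      using \<open>V \<in> cover\<close> False unfolding cover_def by blast
    have "V = (\<Union>\<gamma>\<in>\<Gamma>. {x. x + \<gamma> \<in> U c \<inter> P})" using c by auto
    moreover have "open (\<Union>\<gamma>\<in>\<Gamma>. {x. x + \<gamma> \<in> U c \<inter> P})"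
      using U[OF c(1)] P(1) by (intro open_UN ballI open_translate_right open_Int) auto
    ultimately show ?thesis by simp
  qed (use oE in auto)
  moreover have "\<Union>cover = UNIV"
  proof -
    have "x \<in> \<Union>cover" for x
    proof (cases "x \<in> E")
      case False
      then obtain \<gamma> where "\<gamma> \<in> \<Gamma>" "x + \<gamma> \<in> P" by (auto simp: E_def)
      then show ?thesis using U[of "x + \<gamma>"] by (auto simp: cover_def)
    qed (simp add: cover_def)
    then show ?thesis by blast
  qed
  ultimately obtain \<F> where F: "finite \<F>" "\<F> \<subseteq> cover"
    "\<And>x. \<exists>V\<in>\<F>. \<exists>u\<in>V. \<exists>\<gamma>\<in>\<Gamma>. x = u + \<gamma>"
    using cocompact[of cover] by blast
  then have sub: "finite (\<F> - {E})" "\<F> - {E} \<subseteq> (\<lambda>c. {x. \<exists>\<gamma>\<in>\<Gamma>. x + \<gamma> \<in> U c \<inter> P}) ` P"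
    by (auto simp: cover_def)
  from finite_subset_image[OF sub] obtain F' where F': "F' \<subseteq> P" "finite F'"
    "\<F> - {E} = (\<lambda>c. {x. \<exists>\<gamma>\<in>\<Gamma>. x + \<gamma> \<in> U c \<inter> P}) ` F'"
    by blast
  have "\<exists>c\<in>F'. \<exists>u\<in>U c \<inter> P. \<exists>\<gamma>\<in>\<Gamma> \<inter> P. x = u + \<gamma>" if x: "x \<in> P" for x
  proof -
    obtain V v \<gamma> where V: "V \<in> \<F>" "v \<in> V" "\<gamma> \<in> \<Gamma>" "x = v + \<gamma>" using F(3) by blast
    have "v \<notin> E" using V x by (auto simp: E_def)
    then have "V \<in> \<F> - {E}" using V by blast
    from this[unfolded F'(3)] obtain c where c: "V = {x. \<exists>\<gamma>\<in>\<Gamma>. x + \<gamma> \<in> U c \<inter> P}" "c \<in> F'"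
      by (rule imageE)
    then obtain \<delta> where \<delta>: "\<delta> \<in> \<Gamma>" "v + \<delta> \<in> U c" "v + \<delta> \<in> P" using V by blast
    \<comment> \<open>\<open>v + \<delta>\<close> and \<open>x\<close> both lie in \<open>P\<close>,
      hence so does the lattice element between them.\<close>
    have eq: "x = (v + \<delta>) + (- \<delta> + \<gamma>)" using V by (simp add: group_word del: add_uminus_conv_diff)
    have "- (v + \<delta>) + x \<in> P" using \<delta> x P(2) by (auto simp: subgroup_of_def)
    then have "- \<delta> + \<gamma> \<in> P"
      using V by (simp add: group_word del: add_uminus_conv_diff)
    moreover have "- \<delta> + \<gamma> \<in> \<Gamma>" using \<delta> V by (intro \<Gamma>_closed)
    ultimately have "- \<delta> + \<gamma> \<in> \<Gamma> \<inter> P" by blast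
    then show ?thesis using eq c \<delta> by blast
  qed
  then show ?thesis using F' by blast
qed

text \<open>Small roots pass from \<open>D\<close> to every \<open>low k\<close> modulo the next
  term. There the quotient is abelian, so sums of roots are roots of sums; and by biadditivity
  \<open>comm a\<close> turns an \<open>n\<close>-th root of \<open>b\<close> into one of
  \<open>comm a b\<close>, which is small since \<open>comm a 0 = 0\<close>.\<close>

lemma low_divisible:
  assumes "x \<in> low k" "open V" "0 \<in> V"
  shows "\<forall>\<^sub>F n in sequentially. \<exists>h\<in>V \<inter> low k. eqv (Suc k) (nmul n h) x"
proof -
  define Q where "Q k x \<longleftrightarrow> x \<in> low k \<and> (\<forall>V. open V \<longrightarrow> 0 \<in> V \<longrightarrow>
    (\<forall>\<^sub>F n in sequentially. \<exists>h\<in>V \<inter> low k. eqv (Suc k) (nmul n h) x))" for k x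
  have zero: "Q k 0" for k
    unfolding Q_def using low_closed(1) by (auto intro!: always_eventually bexI[of _ 0])
  have add: "Q k (x + y)" if "Q k x" "Q k y" for k x y
    unfolding Q_def
  proof (intro conjI allI impI)
    show "x + y \<in> low k" using that low_closed by (auto simp: Q_def)
    fix V :: "'g set" assume V: "open V" "0 \<in> V"
    have "open ((\<lambda>p::'g\<times>'g. fst p + snd p) -` V)" by (intro open_vimage V cont_intros)
    moreover have "(0, 0) \<in> (\<lambda>p::'g\<times>'g. fst p + snd p) -` V" using V by simp
    ultimately obtain A B :: "'g set" where AB: "open A" "open B" "(0, 0) \<in> A \<times> B"
      "A \<times> B \<subseteq> (\<lambda>p. fst p + snd p) -` V" by (rule open_prod_elim)
    have "\<forall>\<^sub>F n in sequentially. \<exists>h\<in>A \<inter> low k. eqv (Suc k) (nmul n h) x"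
      "\<forall>\<^sub>F n in sequentially. \<exists>h\<in>B \<inter> low k. eqv (Suc k) (nmul n h) y"
      using that AB by (auto simp: Q_def)
    then show "\<forall>\<^sub>F n in sequentially. \<exists>h\<in>V \<inter> low k. eqv (Suc k) (nmul n h) (x + y)"
    proof eventually_elim
      case (elim n)
      then obtain h h' where h: "h \<in> A" "h \<in> low k" "eqv (Suc k) (nmul n h) x"
        and h': "h' \<in> B" "h' \<in> low k" "eqv (Suc k) (nmul n h') y" by blast
      have "eqv (Suc k) (nmul n (h + h')) (nmul n h + nmul n h')" by (intro nmul_add_eqv h h')
      also have "eqv (Suc k) \<dots> (x + y)"
        using h h' low_H[OF low_closed(4)] by (intro eqv_add) auto
      finally show ?case using AB h h' low_closed(2) by (intro bexI[of _ "h + h'"]) auto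
    qed
  qed
  have inv: "Q k (- x)" if "Q k x" for k x
    unfolding Q_def
  proof (intro conjI allI impI)
    show "- x \<in> low k" using that low_closed by (auto simp: Q_def)
    fix V :: "'g set" assume V: "open V" "0 \<in> V"
    have "open (uminus -` V)" by (intro open_vimage V cont_intros)
    then have "\<forall>\<^sub>F n in sequentially. \<exists>h\<in>uminus -` V \<inter> low k. eqv (Suc k) (nmul n h) x"
      using that V by (auto simp: Q_def)
    then show "\<forall>\<^sub>F n in sequentially. \<exists>h\<in>V \<inter> low k. eqv (Suc k) (nmul n h) (- x)"
    proof eventually_elim
      case (elim n)
      then obtain h where h: "- h \<in> V" "h \<in> low k" "eqv (Suc k) (nmul n h) x" by blast
      have "eqv (Suc k) (nmul n h + nmul n (- h)) (nmul n (h + - h))"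
        using h low_closed(3) by (intro eqv_sym[OF nmul_add_eqv]) auto
      then have "eqv (Suc k) (nmul n (- h)) (- nmul n h)" by (intro eqv_cancel) simp
      also have "eqv (Suc k) (- nmul n h) (- x)"
        using h low_H[OF low_closed(4)] by (intro eqv_minus) auto
      finally show ?case using h low_closed(3) by (intro bexI[of _ "- h"]) auto
    qed
  qed
  have "Q k x" if "x \<in> low k" for k x
    using that
  proof (induction k arbitrary: x)
    case 0
    then have "x \<in> gen_subgroup small_divisible" by simp
    then show ?case
    proof induction
      case (base x)
      show ?case unfolding Q_def
      proof (intro conjI allI impI)
        show "x \<in> low 0" using base by (auto intro: gen_subgroup.base)
        fix V :: "'g set" assume V: "open V" "0 \<in> V"
        \<comment> \<open>The neighbourhood is shrunk to the open subgroup \<open>low 0\<close>, so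
          that the roots themselves lie in \<open>low 0\<close>.\<close>
        have "open (V \<inter> low 0)" "0 \<in> V \<inter> low 0"
          using V open_low_0 low_closed(1)[of 0] by (auto simp del: low.simps)
        then have "\<forall>\<^sub>F n in sequentially. \<exists>h\<in>V \<inter> low 0. nmul n h = x"
          using base unfolding small_divisible_def by blast
        then show "\<forall>\<^sub>F n in sequentially. \<exists>h\<in>V \<inter> low 0. eqv (Suc 0) (nmul n h) x"
          by eventually_elim (metis eqv_refl)
      qed
    qed (auto intro: zero add inv)
  next
    case (Suc k)
    then have "x \<in> gen_subgroup {comm a b | a b. a \<in> H \<and> b \<in> low k}" by simp
    then show ?case
    proof induction
      case (base x)
      then obtain a b where x: "x = comm a b" and a: "a \<in> H" and b: "b \<in> low k" by blast
      show ?case unfolding Q_def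
      proof (intro conjI allI impI)
        show "x \<in> low (Suc k)" unfolding x by (rule comm_low[OF a b])
        fix V :: "'g set" assume V: "open V" "0 \<in> V"
        have "open (comm a -` V)" by (intro open_vimage V cont_intros)
        then have "\<forall>\<^sub>F n in sequentially. \<exists>h\<in>comm a -` V \<inter> low k. eqv (Suc k) (nmul n h) b"
          using Suc.IH[OF b] V by (auto simp: Q_def)
        then show "\<forall>\<^sub>F n in sequentially. \<exists>h\<in>V \<inter> low (Suc k). eqv (Suc (Suc k)) (nmul n h) x"
        proof eventually_elim
          case (elim n)
          then obtain h where h: "comm a h \<in> V" "h \<in> low k" "eqv (Suc k) (nmul n h) b" by blast
          have "eqv (Suc (Suc k)) (nmul n (comm a h)) (comm a (nmul n h))"
            by (intro eqv_sym[OF comm_nmul_right_eqv] a h)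
          also have "eqv (Suc (Suc k)) (comm a (nmul n h)) x"
            unfolding x using a h low_closed(4) by (intro comm_eqv_right) auto
          finally show ?case using h comm_low[OF a h(2)] by (intro bexI[of _ "comm a h"]) auto
        qed
      qed
    qed (auto intro: zero add inv)
  qed
  then show ?thesis using assms unfolding Q_def by blast
qed

end

section \<open>Density of commutators with \<tau> modulo the lattice\<close>

context nilrotation
begin

text \<open>With \<open>k = Suc j\<close> this is the set [\<tau>, low (k-1)] + low (k+1) + \<Gamma>
  of the overview, with lattice elements in \<open>H\<close>. Single commutators suffice, as
  \<open>comm \<tau>\<close> is additive on \<open>low j\<close> modulo
  \<open>low (Suc (Suc j))\<close>.\<close>

definition reach :: "nat \<Rightarrow> 'g set" where
  "reach j = {x. \<exists>h\<in>low j. \<exists>\<gamma>\<in>\<Gamma> \<inter> H. eqv (Suc (Suc j)) x (comm \<tau> h + \<gamma>)}"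

lemma reachI: "h \<in> low j \<Longrightarrow> \<gamma> \<in> \<Gamma> \<inter> H \<Longrightarrow> eqv (Suc (Suc j)) x (comm \<tau> h + \<gamma>) \<Longrightarrow> x \<in> reach j"
  unfolding reach_def by blast

lemma comm_tau_H: "h \<in> low j \<Longrightarrow> comm \<tau> h \<in> H"
  using low_H[OF comm_low[OF tau_H]] by blast

lemma reach_H: "x \<in> reach j \<Longrightarrow> x \<in> H"
  unfolding reach_def using eqv_H[OF eqv_sym] H_closed(2) comm_tau_H by blast

text \<open>\<open>comm \<tau>\<close> is additive with values in \<open>low (Suc j)\<close>, which
  is central modulo \<open>low (Suc (Suc j))\<close>, so lattice elements can be moved past
  them.\<close>

lemma subgroup_reach: "subgroup_of (reach j)"
  unfolding subgroup_of_def
proof (intro conjI ballI)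
  show "0 \<in> reach j"
    using subgroup_of_zero[OF subgroup_\<Gamma>H] low_closed(1)
    by (intro reachI[of 0 j 0]) auto
next
  fix x y assume x: "x \<in> reach j" and y: "y \<in> reach j"
  let ?k = "Suc (Suc j)"
  obtain h \<gamma> where h: "h \<in> low j" "\<gamma> \<in> \<Gamma> \<inter> H" "eqv ?k x (comm \<tau> h + \<gamma>)"
    using x unfolding reach_def by blast
  obtain h' \<gamma>' where h': "h' \<in> low j" "\<gamma>' \<in> \<Gamma> \<inter> H" "eqv ?k y (comm \<tau> h' + \<gamma>')"
    using y unfolding reach_def by blast
  have c: "comm \<tau> h \<in> low (Suc j)" "comm \<tau> h' \<in> low (Suc j)"
    using comm_low[OF tau_H] h h' by blast+
  have "eqv ?k (x + y) ((comm \<tau> h + \<gamma>) + (comm \<tau> h' + \<gamma>'))"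
    using h h' reach_H[OF y] by (intro eqv_add) auto
  also have "(comm \<tau> h + \<gamma>) + (comm \<tau> h' + \<gamma>') = comm \<tau> h + ((\<gamma> + comm \<tau> h') + \<gamma>')"
    by (simp add: add.assoc)
  also have "eqv ?k \<dots> (comm \<tau> h + ((comm \<tau> h' + \<gamma>) + \<gamma>'))"
    using h h' c by (intro eqv_add_left eqv_add_right eqv_commute) auto
  also have "comm \<tau> h + ((comm \<tau> h' + \<gamma>) + \<gamma>') = (comm \<tau> h + comm \<tau> h') + (\<gamma> + \<gamma>')"
    by (simp add: add.assoc)
  also have "eqv ?k \<dots> (comm \<tau> (h + h') + (\<gamma> + \<gamma>'))"
    using h h' tau_H H_closed(2)
    by (intro eqv_add_right eqv_sym[OF comm_add_right_eqv]) auto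
  finally show "x + y \<in> reach j"
    using h h' low_closed(2) subgroup_of_add[OF subgroup_\<Gamma>H] by (intro reachI) auto
next
  fix x assume x: "x \<in> reach j"
  let ?k = "Suc (Suc j)"
  obtain h \<gamma> where h: "h \<in> low j" "\<gamma> \<in> \<Gamma> \<inter> H" "eqv ?k x (comm \<tau> h + \<gamma>)"
    using x unfolding reach_def by blast
  have c: "- comm \<tau> h \<in> low (Suc j)" using comm_low[OF tau_H] h low_closed(3) by blast
  have \<gamma>: "- \<gamma> \<in> \<Gamma> \<inter> H" using h subgroup_of_minus[OF subgroup_\<Gamma>H] by blast
  have "eqv ?k (- x) (- (comm \<tau> h + \<gamma>))" using h reach_H[OF x] by (intro eqv_minus)
  also have "- (comm \<tau> h + \<gamma>) = - \<gamma> + - comm \<tau> h" by (simp only: minus_add)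
  also have "eqv ?k \<dots> (- comm \<tau> h + - \<gamma>)" using c \<gamma> by (intro eqv_commute) auto
  also have "eqv ?k \<dots> (comm \<tau> (- h) + - \<gamma>)"
    using h \<gamma> tau_H by (intro eqv_add_right eqv_sym[OF comm_minus_right_eqv]) auto
  finally show "- x \<in> reach j" using low_closed(3)[OF h(1)] \<gamma> by (rule reachI[rotated 2])
qed

lemmas cl_reach_closed = subgroup_of_zero[OF subgroup_of_closure[OF subgroup_reach]]
  subgroup_of_add[OF subgroup_of_closure[OF subgroup_reach]]
  subgroup_of_minus[OF subgroup_of_closure[OF subgroup_reach]]

lemma low_reach: "x \<in> low (Suc (Suc j)) \<Longrightarrow> x \<in> reach j"
  using subgroup_of_zero[OF subgroup_\<Gamma>H] low_closed(1) low_closed(3)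
  by (intro reachI[of 0 j 0]) (auto simp: eqv_def simp del: low.simps)

lemma comm_tau_reach: "h \<in> low j \<Longrightarrow> comm \<tau> h \<in> reach j"
  using subgroup_of_zero[OF subgroup_\<Gamma>H] by (intro reachI[of h j 0]) auto

lemma cl_reach_eqv:
  assumes "x \<in> closure (reach j)" "eqv (Suc (Suc j)) x y"
  shows "y \<in> closure (reach j)"
proof -
  have "- x + y \<in> closure (reach j)"
    using assms(2) low_reach closure_subset unfolding eqv_def by blast
  then show ?thesis using cl_reach_closed(2)[OF assms(1), of "- x + y"] by simp
qed

text \<open>The elements of \<open>low j\<close> that are null for the commutator pairing with
  \<open>H\<close> when values are read modulo \<open>closure (reach j)\<close>. The aim is to show
  that they fill \<open>low j\<close>.\<close>

definition annihil :: "nat \<Rightarrow> 'g set" where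
  "annihil j = {z \<in> low j. \<forall>g\<in>H. comm g z \<in> closure (reach j)}"

lemma annihil_eqv:
  assumes z: "z \<in> annihil j" and e: "eqv (Suc j) z z'"
  shows "z' \<in> annihil j"
proof -
  have l: "z \<in> low j" using z by (simp add: annihil_def)
  have "z' \<in> low j" using eqv_low[OF eqv_mono[OF e] l] .
  moreover have "comm g z' \<in> closure (reach j)" if "g \<in> H" for g
    using z that comm_eqv_right[OF that l e] cl_reach_eqv by (auto simp: annihil_def)
  ultimately show ?thesis by (simp add: annihil_def)
qed

lemma annihil_add:
  assumes z: "z \<in> annihil j" and z': "z' \<in> annihil j"
  shows "z + z' \<in> annihil j"
proof -
  have "comm g (z + z') \<in> closure (reach j)" if g: "g \<in> H" for g
    using z z' comm_add_right_eqv[OF g, of z j z'] cl_reach_closed(2) g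
      cl_reach_eqv[OF _ eqv_sym] unfolding annihil_def by blast
  then show ?thesis using z z' low_closed(2) by (simp add: annihil_def)
qed

lemma annihil_minus:
  assumes z: "z \<in> annihil j"
  shows "- z \<in> annihil j"
proof -
  have "comm g (- z) \<in> closure (reach j)" if g: "g \<in> H" for g
    using z comm_minus_right_eqv[OF g, of z j] cl_reach_closed(3) g
      cl_reach_eqv[OF _ eqv_sym] unfolding annihil_def by blast
  then show ?thesis using z low_closed(3) by (simp add: annihil_def)
qed

lemma annihil_zero: "0 \<in> annihil j"
  using low_closed(1) cl_reach_closed(1) by (simp add: annihil_def)

text \<open>For \<open>g = nmul n \<tau> + \<gamma>\<close> the commutator \<open>comm g z\<close>
  is congruent to \<open>comm \<tau> (nmul n z) + comm \<gamma> z\<close>, whose second summand is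
  in \<Gamma>. Such \<open>g\<close> are dense in \<open>H\<close>, and \<open>comm\<close> is
  continuous.\<close>

lemma \<Gamma>_annihil:
  assumes z: "z \<in> \<Gamma> \<inter> low j"
  shows "z \<in> annihil j"
proof -
  have zl: "z \<in> low j" and zG: "z \<in> \<Gamma>" using z by auto
  have orbit: "comm (nmul n \<tau> + \<gamma>) z \<in> reach j" if \<gamma>: "\<gamma> \<in> \<Gamma> \<inter> H" for n \<gamma>
  proof (rule reachI)
    show "nmul n z \<in> low j" using zl by (rule low_closed(4))
    have "comm \<gamma> z \<in> \<Gamma>" unfolding comm_def using \<gamma> zG by (intro \<Gamma>_closed) auto
    then show "comm \<gamma> z \<in> \<Gamma> \<inter> H" using \<gamma> low_H[OF comm_low[of \<gamma> z j]] zl by auto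
    have "eqv (Suc (Suc j)) (comm (nmul n \<tau> + \<gamma>) z) (comm (nmul n \<tau>) z + comm \<gamma> z)"
      using \<gamma> zl tau_H by (intro comm_add_left_eqv H_closed) auto
    also have "eqv (Suc (Suc j)) \<dots> (comm \<tau> (nmul n z) + comm \<gamma> z)"
      using zl tau_H \<open>comm \<gamma> z \<in> \<Gamma> \<inter> H\<close>
      by (intro eqv_add_right eqv_trans[OF comm_nmul_left_eqv eqv_sym[OF comm_nmul_right_eqv]]) auto
    finally show "eqv (Suc (Suc j)) (comm (nmul n \<tau> + \<gamma>) z) (comm \<tau> (nmul n z) + comm \<gamma> z)" .
  qed
  have "comm g z \<in> closure (reach j)" if g: "g \<in> H" for g
  proof (rule mem_closureI)
    fix V :: "'g set" assume V: "open V" "0 \<in> V"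
    define U where "U = (\<lambda>x. comm g z + - comm x z) -` V"
    have "open U" unfolding U_def by (intro open_vimage V cont_intros)
    moreover have "g \<in> U" using V by (simp add: U_def)
    ultimately obtain n \<gamma> where n: "\<gamma> \<in> \<Gamma> \<inter> H" "nmul n \<tau> + \<gamma> \<in> U" using dense_in_H g by blast
    then have "comm g z + - comm (nmul n \<tau> + \<gamma>) z \<in> V" by (simp add: U_def)
    moreover have "comm (nmul n \<tau> + \<gamma>) z \<in> closure (reach j)"
      using orbit[OF n(1)] closure_subset by blast
    ultimately show "\<exists>v\<in>V. \<exists>a\<in>closure (reach j). comm g z = v + a"
      by (intro bexI[of _ "comm g z + - comm (nmul n \<tau> + \<gamma>) z"] bexI[of _ "comm (nmul n \<tau> + \<gamma>) z"])
        (simp_all add: add.assoc)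
  qed
  then show ?thesis using zl by (simp add: annihil_def)
qed

text \<open>If \<open>g = nmul n g'\<close>, then modulo higher commutators \<open>comm g (f x)\<close> equals
  \<open>comm g' (f (nmul n x))\<close>, where \<open>g'\<close> tends to \<open>0\<close> while \<open>nmul n x\<close> stays in a compact set
  modulo the lattice.\<close>
lemma hom_into_annihil:
  assumes P: "open P" "subgroup_of P" "P \<subseteq> H"
    and f: "continuous_on UNIV f" "\<And>x. x \<in> P \<Longrightarrow> f x \<in> low j"
      "\<And>x y. x \<in> P \<Longrightarrow> y \<in> P \<Longrightarrow> eqv (Suc j) (f (x + y)) (f x + f y)"
    and f\<Gamma>: "\<And>\<gamma>. \<gamma> \<in> \<Gamma> \<inter> P \<Longrightarrow> f \<gamma> \<in> annihil j"
    and x: "x \<in> P"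
  shows "f x \<in> annihil j"
proof -
  have z: "f x \<in> low j" using f(2) x .
  have nmul_f: "eqv (Suc j) (nmul n (f x)) (f (nmul n x))" for n
  proof (induction n)
    case 0
    have "eqv (Suc j) (- f 0 + f 0) (- f 0 + (f 0 + f 0))"
      using f(3)[of 0 0] subgroup_of_zero[OF P(2)] by (intro eqv_add_left) simp
    then show ?case by simp
  next
    case (Suc n)
    have "eqv (Suc j) (f x + nmul n (f x)) (f x + f (nmul n x))" by (intro eqv_add_left Suc)
    also have "eqv (Suc j) \<dots> (f (x + nmul n x))"
      using x subgroup_of_nmul[OF P(2)] by (intro eqv_sym[OF f(3)]) auto
    finally show ?case by simp
  qed
  have D: "comm g (f x) \<in> closure (reach j)" if g: "g \<in> small_divisible" for g
  proof (rule mem_closureI)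
    fix V :: "'g set" assume V: "open V" "0 \<in> V"
    \<comment> \<open>Tube argument: finitely many of the sets \<open>B c\<close> cover
      \<open>P\<close> modulo the lattice, and the intersection of the corresponding
      \<open>A c\<close> is one neighbourhood of 0 that works for all of them.\<close>
    have "\<exists>A B. open A \<and> open B \<and> 0 \<in> A \<and> c \<in> B \<and> (\<forall>a\<in>A. \<forall>b\<in>B. comm a (f b) \<in> V)" for c
    proof -
      have "continuous_on UNIV (\<lambda>p::'g\<times>'g. comm (fst p) (f (snd p)))"
        by (intro cont_intros continuous_on_compose2[OF f(1)]) auto
      then have "open ((\<lambda>p::'g\<times>'g. comm (fst p) (f (snd p))) -` V)" using V by (intro open_vimage)
      moreover have "(0, c) \<in> (\<lambda>p::'g\<times>'g. comm (fst p) (f (snd p))) -` V" using V by simp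
      ultimately obtain A B :: "'g set" where "open A" "open B" "(0, c) \<in> A \<times> B"
        "A \<times> B \<subseteq> (\<lambda>p. comm (fst p) (f (snd p))) -` V" by (rule open_prod_elim)
      then show ?thesis by (intro exI[of _ A] exI[of _ B]) auto
    qed
    then obtain A B where AB: "\<And>c. open (A c)" "\<And>c. open (B c)" "\<And>c. 0 \<in> A c" "\<And>c. c \<in> B c"
      "\<And>c a b. a \<in> A c \<Longrightarrow> b \<in> B c \<Longrightarrow> comm a (f b) \<in> V" by metis
    obtain F where F: "finite F" "F \<subseteq> P"
      "\<And>y. y \<in> P \<Longrightarrow> \<exists>c\<in>F. \<exists>u\<in>B c \<inter> P. \<exists>\<gamma>\<in>\<Gamma> \<inter> P. y = u + \<gamma>"
      using cocompact_open_subgroup[OF P(1,2), of B] AB by metis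
    define W where "W = H \<inter> (\<Inter>c\<in>F. A c)"
    have "open W" "0 \<in> W"
      unfolding W_def using open_H F(1) AB H_closed(1) by (auto intro!: open_Int open_INT)
    then have "\<forall>\<^sub>F n in sequentially. \<exists>h\<in>W. nmul n h = g"
      using g unfolding small_divisible_def by blast
    then obtain n g' where g': "g' \<in> W" "nmul n g' = g" by (auto simp: eventually_sequentially)
    have g'H: "g' \<in> H" using g' by (simp add: W_def)
    have yP: "nmul n x \<in> P" using x P(2) subgroup_of_nmul by blast
    obtain c u \<gamma> where c: "c \<in> F" "u \<in> B c" "u \<in> P" "\<gamma> \<in> \<Gamma> \<inter> P" "nmul n x = u + \<gamma>"
      using F(3)[OF yP] by blast
    have v: "comm g' (f u) \<in> V" using AB(5)[of g' c u] g' c by (auto simp: W_def)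
    have fl: "f u \<in> low j" "f \<gamma> \<in> low j" "f (u + \<gamma>) \<in> low j" using f(2) c yP by auto
    have "eqv (Suc (Suc j)) (comm (nmul n g') (f x)) (comm g' (nmul n (f x)))"
      using g'H z by (intro eqv_trans[OF comm_nmul_left_eqv eqv_sym[OF comm_nmul_right_eqv]])
    also have "eqv (Suc (Suc j)) \<dots> (comm g' (f (u + \<gamma>)))"
      using nmul_f[of n] c low_closed(4)[OF z] g'H by (intro comm_eqv_right) auto
    also have "eqv (Suc (Suc j)) \<dots> (comm g' (f u + f \<gamma>))"
      using f(3)[of u \<gamma>] c g'H fl by (intro comm_eqv_right) auto
    also have "eqv (Suc (Suc j)) \<dots> (comm g' (f u) + comm g' (f \<gamma>))"
      using g'H fl by (intro comm_add_right_eqv)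
    finally have e: "eqv (Suc (Suc j)) (comm g (f x)) (comm g' (f u) + comm g' (f \<gamma>))"
      using g' by simp
    \<comment> \<open>After the small term \<open>comm g' (f u)\<close> is split off, the rest is
      congruent to \<open>comm g' (f \<gamma>)\<close>, which \<open>f\<Gamma>\<close>
      controls.\<close>
    define a where "a = - comm g' (f u) + comm g (f x)"
    have "comm g' (f \<gamma>) \<in> closure (reach j)"
      using f\<Gamma>[OF c(4)] g'H by (simp add: annihil_def)
    moreover have "eqv (Suc (Suc j)) (comm g' (f \<gamma>)) a"
      using eqv_add_left[OF eqv_sym[OF e], of "- comm g' (f u)"] by (simp add: a_def)
    ultimately have "a \<in> closure (reach j)" by (rule cl_reach_eqv)
    then show "\<exists>v\<in>V. \<exists>a\<in>closure (reach j). comm g (f x) = v + a"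
      using v by (intro bexI[of _ "comm g' (f u)"] bexI[of _ a]) (auto simp: a_def)
  qed
  \<comment> \<open>The remaining generator \<tau> of \<open>H\<close> is covered as well:
    \<open>comm \<tau> (f x)\<close> is in \<open>reach j\<close> by definition.\<close>
  have "comm g (f x) \<in> closure (reach j)" if "g \<in> H" for g
    using that unfolding H_def
  proof induction
    case zero
    then show ?case using cl_reach_closed(1) by simp
  next
    case (base g)
    then show ?case using D comm_tau_reach[OF z] closure_subset by blast
  next
    case (add a b)
    have "eqv (Suc (Suc j)) (comm a (f x) + comm b (f x)) (comm (a + b) (f x))"
      using add z by (intro eqv_sym[OF comm_add_left_eqv]) (auto simp: H_def)
    then show ?case using add cl_reach_eqv cl_reach_closed(2) by blast
  next
    case (inv a)
    have "eqv (Suc (Suc j)) (- comm a (f x)) (comm (- a) (f x))"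
      using inv z by (intro eqv_sym[OF comm_minus_left_eqv]) (auto simp: H_def)
    then show ?case using inv cl_reach_eqv cl_reach_closed(3) by blast
  qed
  then show ?thesis using z by (simp add: annihil_def)
qed

text \<open>Induction from the innermost entry. With \<open>y\<close> in the lattice,
  \<open>x \<mapsto> itcomm gs (comm x y)\<close> is additive on \<open>H\<close> modulo
  \<open>low (Suc j)\<close>; at a lattice element \<open>x\<close> the innermost commutator is
  again in the lattice, one level deeper, so the shorter list applies. Then
  \<open>hom_into_annihil\<close> admits arbitrary \<open>x\<close>.\<close>

lemma itcomm_\<Gamma>_annihil:
  assumes "set gs \<subseteq> H" "k + length gs = j" "y \<in> \<Gamma> \<inter> low k"
  shows "itcomm gs y \<in> annihil j"
  using assms
proof (induction gs arbitrary: k y rule: rev_induct)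
  case Nil
  then show ?case using \<Gamma>_annihil by simp
next
  case (snoc g gs)
  define f where "f = (\<lambda>x. itcomm gs (comm x y))"
  have gs: "set gs \<subseteq> H" "Suc k + length gs = j" and y: "y \<in> low k" "y \<in> \<Gamma>" using snoc.prems by auto
  have "f g \<in> annihil j"
  proof (rule hom_into_annihil[where f=f and P=H, OF open_H subgroup_H])
    show "continuous_on UNIV f" unfolding f_def by (intro cont_itcomm cont_intros)
    show "f x \<in> low j" if "x \<in> H" for x
      using itcomm_low[OF gs(1) comm_low[OF that y(1)]] gs(2) by (simp add: f_def del: low.simps)
    show "eqv (Suc j) (f (x + x')) (f x + f x')" if x: "x \<in> H" "x' \<in> H" for x x'
    proof -
      have "eqv (Suc j) (f (x + x')) (itcomm gs (comm x y + comm x' y))"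
        using itcomm_eqv[OF gs(1) comm_low[OF H_closed(2)[OF x] y(1)] comm_add_left_eqv[OF x y(1)]] gs(2)
        by (simp add: f_def)
      also have "eqv (Suc j) \<dots> (f x + f x')"
        using itcomm_add_eqv[OF gs(1) comm_low[OF x(1) y(1)] comm_low[OF x(2) y(1)]] gs(2)
        by (simp add: f_def)
      finally show ?thesis .
    qed
    show "f \<gamma> \<in> annihil j" if "\<gamma> \<in> \<Gamma> \<inter> H" for \<gamma>
    proof -
      have "comm \<gamma> y \<in> \<Gamma>" unfolding comm_def using that y(2) by (intro \<Gamma>_closed) auto
      then show ?thesis
        unfolding f_def using snoc.IH[OF gs(1), of "Suc k"] gs(2) that comm_low[of \<gamma> y k] y(1) by auto
    qed
  qed (use snoc.prems in auto)
  then show ?case by (simp add: f_def)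
qed

text \<open>Only the innermost entry is still bound to the lattice. On the open subgroup
  \<open>low 0\<close>, \<open>hom_into_annihil\<close> frees it; in a higher term a generator
  \<open>comm a b\<close> is unfolded, with \<open>a\<close> joining the list, until level 0 is
  reached.\<close>

lemma itcomm_annihil:
  assumes "set gs \<subseteq> H" "k + length gs = j" "x \<in> low k"
  shows "itcomm gs x \<in> annihil j"
  using assms
proof (induction k arbitrary: gs x)
  case 0
  show ?case
  proof (rule hom_into_annihil[where f="itcomm gs" and P="low 0", OF open_low_0 subgroup_low])
    show "continuous_on UNIV (itcomm gs)"
      using cont_itcomm[OF continuous_on_id, of UNIV gs] by simp
    show "itcomm gs x \<in> low j" if "x \<in> low 0" for x
      using itcomm_low[OF 0(1) that] 0(2) by simp
    show "eqv (Suc j) (itcomm gs (x + y)) (itcomm gs x + itcomm gs y)" if "x \<in> low 0" "y \<in> low 0" for x y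
      using itcomm_add_eqv[OF 0(1) that] 0(2) by simp
    show "itcomm gs \<gamma> \<in> annihil j" if "\<gamma> \<in> \<Gamma> \<inter> low 0" for \<gamma>
      using itcomm_\<Gamma>_annihil[OF 0(1,2) that] .
    show "low 0 \<subseteq> H" using low_H by blast
  qed (rule 0(3))
next
  case (Suc k)
  let ?S = "{comm a b | a b. a \<in> H \<and> b \<in> low k}"
  have S: "x \<in> low (Suc k)" if "x \<in> gen_subgroup ?S" for x using that by simp
  have "x \<in> gen_subgroup ?S" using Suc.prems by simp
  then show ?case
  proof induction
    case zero
    then show ?case by (simp add: annihil_zero)
  next
    case (base x)
    then obtain a b where x: "x = comm a b" and a: "a \<in> H" and b: "b \<in> low k" by blast
    have "itcomm (gs @ [a]) b \<in> annihil j"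
      using Suc.prems(1,2) a by (intro Suc.IH b) auto
    then show ?case by (simp add: x)
  next
    case (add x y)
    have "eqv (Suc j) (itcomm gs x + itcomm gs y) (itcomm gs (x + y))"
      using eqv_sym[OF itcomm_add_eqv[OF Suc.prems(1) S[OF add.hyps(1)] S[OF add.hyps(2)]]] Suc.prems(2)
      by simp
    then show ?case using add annihil_add annihil_eqv by blast
  next
    case (inv x)
    have "- x \<in> low (Suc k)" using inv S low_closed(3) by blast
    then have "eqv (Suc j) 0 (itcomm gs x + itcomm gs (- x))"
      using itcomm_add_eqv[OF Suc.prems(1) S[OF inv.hyps], of "- x"] Suc.prems(2) by simp
    then have "eqv (Suc j) (- itcomm gs x) (itcomm gs (- x))"
      by (intro eqv_sym[OF eqv_cancel[OF eqv_sym]])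
    then show ?case using inv annihil_minus annihil_eqv by blast
  qed
qed

text \<open>The empty list in \<open>itcomm_annihil\<close> shows that \<open>annihil j\<close> is
  all of \<open>low j\<close>, and the commutators thus controlled generate
  \<open>low (Suc j)\<close>.\<close>

lemma low_subset_closure_reach: "low (Suc j) \<subseteq> closure (reach j)"
proof -
  have "comm a b \<in> closure (reach j)" if "a \<in> H" "b \<in> low j" for a b
    using itcomm_annihil[of "[]" j j b] that by (simp add: annihil_def)
  then show ?thesis
    unfolding low.simps(2)
    by (intro gen_subgroup_subset[OF subgroup_of_closure[OF subgroup_reach]]) auto
qed

end

section \<open>Return times, by induction along the filtration\<close>

context nilrotation
begin

lemma nhd_add:
  assumes "open V" "(0::'g) \<in> V"
  obtains A where "open A" "0 \<in> A" "\<And>x. x \<in> A \<Longrightarrow> - x \<in> A" "\<And>x y. x \<in> A \<Longrightarrow> y \<in> A \<Longrightarrow> x + y \<in> V"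
    "A \<subseteq> V"
proof -
  have "open ((\<lambda>p::'g\<times>'g. fst p + snd p) -` V)" by (intro open_vimage assms cont_intros)
  moreover have "(0, 0) \<in> (\<lambda>p::'g\<times>'g. fst p + snd p) -` V" using assms by simp
  ultimately obtain A B :: "'g set" where AB: "open A" "open B" "(0, 0) \<in> A \<times> B"
    "A \<times> B \<subseteq> (\<lambda>p. fst p + snd p) -` V" by (rule open_prod_elim)
  define E where "E = (A \<inter> B) \<inter> uminus -` (A \<inter> B)"
  have sum: "x + y \<in> V" if "x \<in> E" "y \<in> E" for x y using that AB(4) by (auto simp: E_def)
  have zero: "0 \<in> E" using AB by (simp add: E_def)
  show ?thesis
  proof (rule that[of E])
    show "open E" unfolding E_def by (intro open_Int open_vimage AB cont_intros)
    show "E \<subseteq> V" using sum[OF _ zero] by auto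
  qed (use sum zero in \<open>auto simp: E_def\<close>)
qed

text \<open>A single \<open>a\<close> is, up to a small error, congruent to some
  \<open>comm \<tau> h0 + \<gamma>1\<close>, and a small \<open>h\<close> with
  \<open>nmul n h\<close> congruent to \<open>- h0\<close> cancels the commutator. To get one
  threshold for all \<open>a\<close>, \<open>H\<close> is cut into finitely many small pieces modulo
  \<Gamma>, and one \<open>h\<close> serves a whole piece.\<close>

lemma tau_correction:
  assumes V: "open V" "0 \<in> V"
  shows "\<forall>\<^sub>F n in sequentially. \<forall>a\<in>low (Suc j). \<exists>h\<in>V \<inter> low j. \<exists>v\<in>V \<inter> H. \<exists>\<gamma>\<in>\<Gamma> \<inter> H.
    eqv (Suc (Suc j)) (a + nmul n (comm \<tau> h)) (v + \<gamma>)"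
proof -
  let ?k = "Suc (Suc j)"
  have "open (V \<inter> H)" "0 \<in> V \<inter> H" using V open_H H_closed(1) by auto
  then obtain V1 where V1: "open V1" "0 \<in> V1" "\<And>x y. x \<in> V1 \<Longrightarrow> y \<in> V1 \<Longrightarrow> x + y \<in> V \<inter> H"
    "V1 \<subseteq> V \<inter> H"
    using nhd_add by metis
  obtain V2 where V2: "open V2" "0 \<in> V2" "\<And>x. x \<in> V2 \<Longrightarrow> - x \<in> V2"
    "\<And>x y. x \<in> V2 \<Longrightarrow> y \<in> V2 \<Longrightarrow> x + y \<in> V1" "V2 \<subseteq> V1"
    using nhd_add[OF V1(1,2)] by metis
  define U where "U c = {x. x + - c \<in> V2}" for c
  define T where "T c = {u \<in> U c. \<exists>a\<in>low (Suc j). \<exists>\<gamma>\<in>\<Gamma> \<inter> H. u = a + \<gamma>}" for c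
  define Q where "Q n u \<longleftrightarrow> (\<exists>h\<in>V \<inter> low j. \<exists>v\<in>V \<inter> H. \<exists>\<gamma>\<in>\<Gamma> \<inter> H.
    eqv ?k (u + nmul n (comm \<tau> h)) (v + \<gamma>))" for n u
  have claim: "\<forall>\<^sub>F n in sequentially. \<forall>u\<in>T c. Q n u" for c
  proof (cases "T c = {}")
    case False
    \<comment> \<open>The representative \<open>u0\<close> is chosen before \<open>n\<close>, so the
      threshold depends on the piece only.\<close>
    then obtain u0 a0 \<gamma>0 where u0: "u0 + - c \<in> V2" "u0 = a0 + \<gamma>0" "a0 \<in> low (Suc j)" "\<gamma>0 \<in> \<Gamma> \<inter> H"
      unfolding T_def U_def by blast
    obtain v0 m0 where m0: "v0 \<in> V2" "m0 \<in> reach j" "a0 = v0 + m0"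
      using mem_closureD[OF subsetD[OF low_subset_closure_reach u0(3)] V2(1,2)] by blast
    obtain h0 \<gamma>1 where h0: "h0 \<in> low j" "\<gamma>1 \<in> \<Gamma> \<inter> H" "eqv ?k m0 (comm \<tau> h0 + \<gamma>1)"
      using m0(2) unfolding reach_def by blast
    show ?thesis
      using low_divisible[OF low_closed(3)[OF h0(1)] V]
    proof eventually_elim
      case (elim n)
      then obtain h where h: "h \<in> V" "h \<in> low j" "eqv (Suc j) (nmul n h) (- h0)" by blast
      define X where "X = nmul n (comm \<tau> h)"
      have X: "X \<in> low (Suc j)" unfolding X_def by (intro low_closed(4) comm_low tau_H h)
      have "eqv ?k X (comm \<tau> (nmul n h))"
        unfolding X_def by (intro eqv_sym[OF comm_nmul_right_eqv] tau_H h)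
      also have "eqv ?k \<dots> (comm \<tau> (- h0))"
        by (intro comm_eqv_right tau_H low_closed(4) h)
      also have "eqv ?k \<dots> (- comm \<tau> h0)" by (intro comm_minus_right_eqv tau_H h0)
      finally have X': "eqv ?k X (- comm \<tau> h0)" .
      have c: "- comm \<tau> h0 \<in> low (Suc j)" by (intro low_closed(3) comm_low tau_H h0)
      have "eqv ?k (m0 + X) ((comm \<tau> h0 + \<gamma>1) + - comm \<tau> h0)"
        using h0 X' low_H[OF X] by (intro eqv_add)
      also have "(comm \<tau> h0 + \<gamma>1) + - comm \<tau> h0 = comm \<tau> h0 + (\<gamma>1 + - comm \<tau> h0)"
        by (simp only: add.assoc)
      also have "eqv ?k \<dots> (comm \<tau> h0 + (- comm \<tau> h0 + \<gamma>1))"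
        using h0 c by (intro eqv_add_left eqv_commute) auto
      finally have mX: "eqv ?k (m0 + X) \<gamma>1" by simp
      show ?case
      proof
        fix u assume "u \<in> T c"
        then have u: "u + - c \<in> V2" by (simp add: T_def U_def)
        have "(u + - c) + - (u0 + - c) \<in> V1" using u u0 V2 by blast
        then have w: "u + - u0 \<in> V1" by (simp add: group_word del: add_uminus_conv_diff)
        \<comment> \<open>The total error: the displacement from the representative
          \<open>u0\<close> to \<open>u\<close>, followed by the approximation error of
          \<open>a0\<close>.\<close>
        define v where "v = (u + - u0) + v0"
        have v: "v \<in> V \<inter> H" unfolding v_def using w m0 V1(3) V2(5) by blast
        have "u + X = v + (m0 + (\<gamma>0 + X))"
          unfolding v_def using u0(2) m0(3) by (simp add: group_word del: add_uminus_conv_diff)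
        also have "eqv ?k \<dots> (v + (m0 + (X + \<gamma>0)))"
          using u0 X by (intro eqv_add_left eqv_commute) auto
        also have "v + (m0 + (X + \<gamma>0)) = v + ((m0 + X) + \<gamma>0)" by (simp only: add.assoc)
        also have "eqv ?k \<dots> (v + (\<gamma>1 + \<gamma>0))"
          using mX u0 by (intro eqv_add_left eqv_add_right) auto
        finally have "eqv ?k (u + X) (v + (\<gamma>1 + \<gamma>0))" .
        moreover have "\<gamma>1 + \<gamma>0 \<in> \<Gamma> \<inter> H" using h0 u0 subgroup_of_add[OF subgroup_\<Gamma>H] by blast
        ultimately show "Q n u" unfolding Q_def X_def using h v by blast
      qed
    qed
  qed simp
  have "open (U c) \<and> c \<in> U c" for c
    using open_translate_right[OF V2(1), of "- c"] V2(2) by (simp add: U_def)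
  then obtain F where F: "finite F"
    "\<And>x. x \<in> H \<Longrightarrow> \<exists>c\<in>F. \<exists>u\<in>U c \<inter> H. \<exists>\<gamma>\<in>\<Gamma> \<inter> H. x = u + \<gamma>"
    using cocompact_open_subgroup[OF open_H subgroup_H, of U] by metis
  have "\<forall>\<^sub>F n in sequentially. \<forall>c\<in>F. \<forall>u\<in>T c. Q n u"
    using F(1) claim by (intro eventually_ball_finite) auto
  then show ?thesis
  proof eventually_elim
    case (elim n)
    show ?case
    proof
      fix a assume a: "a \<in> low (Suc j)"
      obtain c u \<gamma> where c: "c \<in> F" "u \<in> U c" "\<gamma> \<in> \<Gamma> \<inter> H" "a = u + \<gamma>"
        using F(2)[OF low_H[OF a]] by blast
      have "u = a + - \<gamma>" using c by (simp add: add.assoc)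
      moreover have "- \<gamma> \<in> \<Gamma> \<inter> H" using c subgroup_of_minus[OF subgroup_\<Gamma>H] by blast
      ultimately have "u \<in> T c" using a c(2) unfolding T_def by blast
      then have "Q n u" using elim c(1) by blast
      then obtain h v \<gamma>' where h: "h \<in> V \<inter> low j" "v \<in> V \<inter> H" "\<gamma>' \<in> \<Gamma> \<inter> H"
        "eqv ?k (u + nmul n (comm \<tau> h)) (v + \<gamma>')" unfolding Q_def by blast
      have X: "nmul n (comm \<tau> h) \<in> low (Suc j)" using h by (intro low_closed(4) comm_low tau_H) auto
      have "a + nmul n (comm \<tau> h) = u + (\<gamma> + nmul n (comm \<tau> h))" by (simp add: c add.assoc)
      also have "eqv ?k \<dots> (u + (nmul n (comm \<tau> h) + \<gamma>))"
        using c X by (intro eqv_add_left eqv_commute) auto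
      also have "u + (nmul n (comm \<tau> h) + \<gamma>) = (u + nmul n (comm \<tau> h)) + \<gamma>" by (simp only: add.assoc)
      also have "eqv ?k \<dots> ((v + \<gamma>') + \<gamma>)" using h c by (intro eqv_add_right) auto
      finally have "eqv ?k (a + nmul n (comm \<tau> h)) (v + (\<gamma>' + \<gamma>))" by (simp only: add.assoc)
      moreover have "\<gamma>' + \<gamma> \<in> \<Gamma> \<inter> H" using h c subgroup_of_add[OF subgroup_\<Gamma>H] by blast
      ultimately show "\<exists>h\<in>V \<inter> low j. \<exists>v\<in>V \<inter> H. \<exists>\<gamma>\<in>\<Gamma> \<inter> H.
          eqv ?k (a + nmul n (comm \<tau> h)) (v + \<gamma>)" using h by blast
    qed
  qed
qed

text \<open>Up to \<open>low k\<close>, \<open>nmul n \<tau>\<close> carries the coset of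
  \<open>g\<close> to that of \<open>g + v\<close>; both are near the coset of 0 when
  \<open>W\<close> is small.\<close>

definition returns :: "nat \<Rightarrow> nat \<Rightarrow> 'g set \<Rightarrow> bool" where
  "returns k n W \<longleftrightarrow> (\<exists>g\<in>W \<inter> H. \<exists>v\<in>W \<inter> H. \<exists>\<gamma>\<in>\<Gamma> \<inter> H. eqv k (- g + nmul n \<tau> + g) (v + \<gamma>))"

text \<open>Conjugating by \<open>g + h\<close> instead of \<open>g\<close> changes the result
  \<open>t\<close> by \<open>comm (- t) (- h)\<close>, which is congruent to
  \<open>nmul n (comm \<tau> h)\<close>. So \<open>tau_correction\<close> can absorb the error
  \<open>a\<close> in \<open>low (Suc j)\<close> left by the induction hypothesis.\<close>

lemma returns_step:
  assumes IH: "\<And>R W. bohr_recurrent R \<Longrightarrow> 0 \<notin> R \<Longrightarrow> open W \<Longrightarrow> 0 \<in> W \<Longrightarrow> \<exists>n\<in>R. returns (Suc j) n W"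
    and R: "bohr_recurrent R" "0 \<notin> R" and W: "open W" "0 \<in> W"
  shows "\<exists>n\<in>R. returns (Suc (Suc j)) n W"
proof -
  let ?k = "Suc (Suc j)"
  obtain V where V: "open V" "0 \<in> V" "\<And>x y. x \<in> V \<Longrightarrow> y \<in> V \<Longrightarrow> x + y \<in> W"
    using nhd_add[OF W] by metis
  obtain n0 where n0: "\<And>n a. n \<ge> n0 \<Longrightarrow> a \<in> low (Suc j) \<Longrightarrow> \<exists>h\<in>V \<inter> low j. \<exists>v\<in>V \<inter> H. \<exists>\<gamma>\<in>\<Gamma> \<inter> H.
    eqv ?k (a + nmul n (comm \<tau> h)) (v + \<gamma>)"
    using tau_correction[OF V(1,2), of j] unfolding eventually_sequentially by blast
  \<comment> \<open>Times below the threshold of \<open>tau_correction\<close> are removed before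
    the induction hypothesis is applied.\<close>
  have "bohr_recurrent {n \<in> R. n \<ge> Suc n0}" using bohr_recurrent_tail[OF R, of "Suc n0"] by simp
  then obtain n where n: "n \<in> R" "n \<ge> n0" "returns (Suc j) n V"
    using IH[of "{n \<in> R. n \<ge> Suc n0}" V] R(2) V by auto
  then obtain g v \<gamma> where g: "g \<in> V" "g \<in> H" "v \<in> V" "v \<in> H" "\<gamma> \<in> \<Gamma> \<inter> H"
    "eqv (Suc j) (- g + nmul n \<tau> + g) (v + \<gamma>)" unfolding returns_def by blast
  define t where "t = - g + nmul n \<tau> + g"
  have tH: "t \<in> H" unfolding t_def using g tau_H by (intro H_closed)
  define a where "a = - v + t + - \<gamma>"
  have "- (v + \<gamma>) + t \<in> low (Suc j)"
    using eqv_sym[OF g(6)] by (simp add: eqv_def t_def)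
  then have "\<gamma> + (- (v + \<gamma>) + t) + - \<gamma> \<in> low (Suc j)" using g by (intro conj_low) auto
  then have a: "a \<in> low (Suc j)" by (simp add: a_def group_word del: add_uminus_conv_diff)
  have t: "t = v + (a + \<gamma>)" by (simp add: a_def group_word del: add_uminus_conv_diff)
  obtain h v' \<gamma>' where h: "h \<in> V" "h \<in> low j" "v' \<in> V" "v' \<in> H" "\<gamma>' \<in> \<Gamma> \<inter> H"
    "eqv ?k (a + nmul n (comm \<tau> h)) (v' + \<gamma>')" using n0[OF n(2) a] by blast
  define X where "X = nmul n (comm \<tau> h)"
  have X: "X \<in> low (Suc j)" unfolding X_def by (intro low_closed(4) comm_low tau_H h)
  have tau_n: "nmul n \<tau> \<in> H" using tau_H by (rule H_closed(4))
  have c: "comm x h \<in> low (Suc j)" if "x \<in> H" for x by (intro comm_low that h)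
  \<comment> \<open>Commutators with \<open>h\<close> are additive in the first entry, so the two
    parts of \<open>t\<close> coming from \<open>g\<close> cancel.\<close>
  have "eqv ?k (comm (- t) (- h)) (- comm t (- h))"
    by (intro comm_minus_left_eqv tH low_closed(3) h)
  also have "eqv ?k \<dots> (- (- comm t h))"
    by (intro eqv_minus[OF comm_minus_right_eqv[OF tH h(2)]] low_H[OF comm_low[OF tH low_closed(3)[OF h(2)]]])
  also have "- (- comm t h) = comm (- g + nmul n \<tau> + g) h" by (simp add: t_def)
  also have "eqv ?k \<dots> (comm (- g + nmul n \<tau>) h + comm g h)"
    by (intro comm_add_left_eqv H_closed(2) H_closed(3) tau_n g h)
  also have "eqv ?k \<dots> ((comm (- g) h + comm (nmul n \<tau>) h) + comm g h)"
    by (intro eqv_add_right comm_add_left_eqv H_closed(3) tau_n g h low_H[OF c])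
  also have "eqv ?k \<dots> ((comm (nmul n \<tau>) h + comm (- g) h) + comm g h)"
    by (intro eqv_add_right eqv_commute low_H[OF c] c H_closed(3) tau_n g)
  also have "eqv ?k \<dots> ((comm (nmul n \<tau>) h + - comm g h) + comm g h)"
    by (intro eqv_add_right eqv_add_left comm_minus_left_eqv low_H[OF c] g h)
  also have "\<dots> = comm (nmul n \<tau>) h" by (simp add: add.assoc)
  also have "eqv ?k \<dots> X" unfolding X_def by (intro comm_nmul_left_eqv tau_H h)
  finally have cX: "eqv ?k (comm (- t) (- h)) X" .
  have "- (g + h) + nmul n \<tau> + (g + h) = t + comm (- t) (- h)"
    by (simp add: t_def comm_def group_word del: add_uminus_conv_diff)
  also have "eqv ?k \<dots> (t + X)" by (intro eqv_add_left cX)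
  also have "t + X = v + (a + (\<gamma> + X))" by (simp add: t add.assoc)
  also have "eqv ?k \<dots> (v + (a + (X + \<gamma>)))"
    using g X by (intro eqv_add_left eqv_commute) auto
  also have "v + (a + (X + \<gamma>)) = v + ((a + X) + \<gamma>)" by (simp only: add.assoc)
  also have "eqv ?k \<dots> (v + ((v' + \<gamma>') + \<gamma>))"
    using g h by (intro eqv_add_left eqv_add_right) (auto simp: X_def)
  also have "v + ((v' + \<gamma>') + \<gamma>) = (v + v') + (\<gamma>' + \<gamma>)" by (simp only: add.assoc)
  finally have "eqv ?k (- (g + h) + nmul n \<tau> + (g + h)) ((v + v') + (\<gamma>' + \<gamma>))" .
  moreover have "g + h \<in> W \<inter> H" using g h V(3) H_closed(2) low_H by blast
  moreover have "v + v' \<in> W \<inter> H" using g h V(3) H_closed(2) by blast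
  moreover have "\<gamma>' + \<gamma> \<in> \<Gamma> \<inter> H" using g h subgroup_of_add[OF subgroup_\<Gamma>H] by blast
  ultimately have "returns ?k n W" unfolding returns_def by blast
  then show ?thesis using n(1) by blast
qed

text \<open>Every forward orbit enters the open set \<open>V \<inter> H\<close> modulo \<Gamma>. By
  compactness the waiting times are bounded, and this is applied to the points
  \<open>nmul k \<tau>\<close>.\<close>

lemma return_times_syndetic:
  assumes V: "open V" "0 \<in> V"
  shows "\<exists>m. \<forall>k. \<exists>i<m. \<exists>v\<in>V \<inter> H. \<exists>\<gamma>\<in>\<Gamma> \<inter> H. nmul (k + i) \<tau> = v + \<gamma>"
proof -
  define A where "A n = (\<Union>\<gamma>\<in>\<Gamma>. {x. nmul n \<tau> + (x + \<gamma>) \<in> V \<inter> H})" for n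
  have VH: "open (V \<inter> H)" "V \<inter> H \<noteq> {}" using V open_H H_closed(1) by auto
  have "open (A n)" for n
    unfolding A_def
    using open_translate_right[OF open_translate_left[OF VH(1), of "nmul n \<tau>"]] by (intro open_UN) simp
  then have oA: "open U" if "U \<in> range A" for U using that by auto
  have cover: "\<Union>(range A) = UNIV"
  proof -
    have "x \<in> \<Union>(range A)" for x
    proof -
      obtain n \<gamma> where "\<gamma> \<in> \<Gamma>" "nmul n \<tau> + x + \<gamma> \<in> V \<inter> H" using dense_orbit[OF VH] by blast
      then have "x \<in> A n" unfolding A_def by (auto simp: add.assoc)
      then show ?thesis by blast
    qed
    then show ?thesis by blast
  qed
  obtain \<F> where F: "finite \<F>" "\<F> \<subseteq> range A"
    "\<And>x. \<exists>U\<in>\<F>. \<exists>u\<in>U. \<exists>\<gamma>\<in>\<Gamma>. x = u + \<gamma>"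
    using cocompact[OF oA cover] by auto
  from finite_subset_image[OF F(1,2)] obtain I where I: "finite I" "\<F> = A ` I" by blast
  show ?thesis
  proof (rule exI[of _ "Suc (Max (insert 0 I))"], rule allI)
    fix k
    obtain U u \<gamma> where u: "U \<in> \<F>" "u \<in> U" "\<gamma> \<in> \<Gamma>" "nmul k \<tau> = u + \<gamma>" using F(3) by blast
    from u(1)[unfolded I(2)] obtain i where "U = A i" "i \<in> I" by (rule imageE)
    with u have i: "i \<in> I" "u \<in> A i" "\<gamma> \<in> \<Gamma>" "nmul k \<tau> = u + \<gamma>" by auto
    then obtain \<delta> where \<delta>: "\<delta> \<in> \<Gamma>" "nmul i \<tau> + (u + \<delta>) \<in> V \<inter> H" by (auto simp: A_def)
    define v where "v = nmul i \<tau> + (u + \<delta>)"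
    have eq: "nmul (k + i) \<tau> = v + (- \<delta> + \<gamma>)"
      using i(4) by (simp add: v_def nmul_add[of i k, folded add.commute[of k i]] group_word del: add_uminus_conv_diff)
    have "- v + nmul (k + i) \<tau> \<in> H" using \<delta> tau_H by (intro H_closed) (auto simp: v_def)
    then have "- \<delta> + \<gamma> \<in> H" by (simp add: eq)
    moreover have "- \<delta> + \<gamma> \<in> \<Gamma>" using \<delta> i by (intro \<Gamma>_closed)
    moreover have "i < Suc (Max (insert 0 I))" using I i by (simp add: less_Suc_eq_le)
    ultimately show "\<exists>i<Suc (Max (insert 0 I)). \<exists>v\<in>V \<inter> H. \<exists>\<gamma>\<in>\<Gamma> \<inter> H. nmul (k + i) \<tau> = v + \<gamma>"
      using eq \<delta>(2) unfolding v_def by blast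
  qed
qed

text \<open>Modulo \<open>low 1\<close> the group \<open>H\<close> is abelian, so closeness to the
  lattice survives sums and inverses. Hence \<open>n = a + b - c - d\<close> with return times
  \<open>a, b, c, d\<close> is a return time to a larger neighbourhood, with conjugating element 0,
  and Bohr recurrence puts such an \<open>n\<close> in \<open>R\<close>.\<close>

lemma returns_base:
  assumes R: "bohr_recurrent R" and W: "open W" "0 \<in> W"
  shows "\<exists>n\<in>R. returns 1 n W"
proof -
  have "open (W \<inter> H)" "0 \<in> W \<inter> H" using W open_H H_closed(1) by auto
  then obtain V1 where V1: "open V1" "0 \<in> V1" "\<And>x y. x \<in> V1 \<Longrightarrow> y \<in> V1 \<Longrightarrow> x + y \<in> W \<inter> H"
    using nhd_add by metis
  obtain V where V: "open V" "0 \<in> V" "\<And>x. x \<in> V \<Longrightarrow> - x \<in> V"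
    "\<And>x y. x \<in> V \<Longrightarrow> y \<in> V \<Longrightarrow> x + y \<in> V1"
    using nhd_add[OF V1(1,2)] by metis
  define S where "S = {n. \<exists>v\<in>V \<inter> H. \<exists>\<gamma>\<in>\<Gamma> \<inter> H. nmul n \<tau> = v + \<gamma>}"
  obtain m where m: "\<And>k. \<exists>i<m. \<exists>v\<in>V \<inter> H. \<exists>\<gamma>\<in>\<Gamma> \<inter> H. nmul (k + i) \<tau> = v + \<gamma>"
    using return_times_syndetic[OF V(1,2)] by blast
  have synd: "\<exists>i<m. k + i \<in> S" for k unfolding S_def using m[of k] by simp
  obtain K :: nat and \<alpha> where K: "\<forall>n. (\<forall>i<K. dist_int (real n * \<alpha> i) < 1/8) \<longrightarrow>
           (\<exists>a\<in>S. \<exists>b\<in>S. \<exists>c\<in>S. \<exists>d\<in>S. n + c + d = a + b)"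
    using syndetic_differences_contain_bohr[OF synd] by blast
  obtain n where n: "n \<in> R" "\<forall>i<K. dist_int (real n * \<alpha> i) < 1/8"
  proof -
    have "(0::real) < 1/8" by simp
    from R[unfolded bohr_recurrent_def, rule_format, OF this, of K \<alpha>] show ?thesis
      using that by blast
  qed
  obtain a b c d where S: "a \<in> S" "b \<in> S" "c \<in> S" "d \<in> S" and sum: "n + c + d = a + b"
    using K n(2) by blast
  define near where "near U x \<longleftrightarrow> (\<exists>v\<in>U \<inter> H. \<exists>\<gamma>\<in>\<Gamma> \<inter> H. eqv 1 x (v + \<gamma>) \<and> x \<in> H)" for U x
  have nearS: "near V (nmul n \<tau>)" if mem: "n \<in> S" for n
  proof -
    obtain v \<gamma> where v: "v \<in> V \<inter> H" "\<gamma> \<in> \<Gamma> \<inter> H" "nmul n \<tau> = v + \<gamma>"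
      using mem unfolding S_def by blast
    have "eqv 1 (nmul n \<tau>) (v + \<gamma>)" unfolding v(3) by (rule eqv_refl)
    then show ?thesis unfolding near_def using v(1,2) H_closed(4)[OF tau_H] by blast
  qed
  have near_minus: "near V (- x)" if x: "near V x" for x
  proof -
    obtain v \<gamma> where v: "v \<in> V \<inter> H" "\<gamma> \<in> \<Gamma> \<inter> H" "eqv 1 x (v + \<gamma>)" "x \<in> H"
      using x unfolding near_def by blast
    have m: "- v \<in> V \<inter> H" "- \<gamma> \<in> \<Gamma> \<inter> H"
      using v V(3) H_closed(3) subgroup_of_minus[OF subgroup_\<Gamma>H] by auto
    have "eqv 1 (- x) (- (v + \<gamma>))" using v by (intro eqv_minus)
    also have "- (v + \<gamma>) = - \<gamma> + - v" by (simp only: minus_add)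
    also have "eqv 1 \<dots> (- v + - \<gamma>)" using m by (intro eqv_commute_1) auto
    finally show ?thesis unfolding near_def using m v(4) H_closed(3) by blast
  qed
  have near_add: "near U' (x + y)"
    if x: "near U x" and y: "near U y" and U: "\<And>x y. x \<in> U \<Longrightarrow> y \<in> U \<Longrightarrow> x + y \<in> U'" for x y U U'
  proof -
    obtain v \<gamma> where v: "v \<in> U \<inter> H" "\<gamma> \<in> \<Gamma> \<inter> H" "eqv 1 x (v + \<gamma>)" "x \<in> H"
      using x unfolding near_def by blast
    obtain w \<delta> where w: "w \<in> U \<inter> H" "\<delta> \<in> \<Gamma> \<inter> H" "eqv 1 y (w + \<delta>)" "y \<in> H"
      using y unfolding near_def by blast
    have "eqv 1 (x + y) ((v + \<gamma>) + (w + \<delta>))" using v w by (intro eqv_add)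
    also have "(v + \<gamma>) + (w + \<delta>) = v + ((\<gamma> + w) + \<delta>)" by (simp only: add.assoc)
    also have "eqv 1 \<dots> (v + ((w + \<gamma>) + \<delta>))"
      using v w by (intro eqv_add_left eqv_add_right eqv_commute_1) auto
    also have "v + ((w + \<gamma>) + \<delta>) = (v + w) + (\<gamma> + \<delta>)" by (simp only: add.assoc)
    finally have "eqv 1 (x + y) ((v + w) + (\<gamma> + \<delta>))" .
    moreover have "v + w \<in> U' \<inter> H" "\<gamma> + \<delta> \<in> \<Gamma> \<inter> H" "x + y \<in> H"
      using v w U H_closed(2) subgroup_of_add[OF subgroup_\<Gamma>H] by blast+
    ultimately show ?thesis unfolding near_def by blast
  qed
  have "nmul n \<tau> + nmul (c + d) \<tau> = nmul a \<tau> + nmul b \<tau>"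
    unfolding nmul_add[symmetric] using sum by (simp add: add.assoc)
  then have "nmul n \<tau> = (nmul a \<tau> + nmul b \<tau>) + - nmul (c + d) \<tau>"
    by (metis add.assoc add.right_inverse add.right_neutral)
  also have "\<dots> = (nmul a \<tau> + nmul b \<tau>) + (- nmul d \<tau> + - nmul c \<tau>)"
    by (simp only: nmul_add minus_add)
  finally have eq: "nmul n \<tau> = (nmul a \<tau> + nmul b \<tau>) + (- nmul d \<tau> + - nmul c \<tau>)" .
  have "near V1 (nmul a \<tau> + nmul b \<tau>)" by (intro near_add[of V] nearS S V(4))
  moreover have "near V1 (- nmul d \<tau> + - nmul c \<tau>)" by (intro near_add[of V] near_minus nearS S V(4))
  ultimately have "near (W \<inter> H) (nmul n \<tau>)" unfolding eq using near_add[of V1 _ _ "W \<inter> H"] V1(3) by blast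
  then obtain v \<gamma> where "v \<in> W \<inter> H" "\<gamma> \<in> \<Gamma> \<inter> H" "eqv 1 (nmul n \<tau>) (v + \<gamma>)"
    unfolding near_def by blast
  moreover have "0 \<in> W \<inter> H" using W(2) H_closed(1) by blast
  moreover have "- 0 + nmul n \<tau> + 0 = nmul n \<tau>" by simp
  ultimately have "returns 1 n W" unfolding returns_def by metis
  then show ?thesis using n(1) by blast
qed

text \<open>The induction starts at level 1 and is read off at level \<open>s\<close>, where
  \<open>low s\<close> is trivial and congruence becomes equality.\<close>

lemma bohr_recurrent_returns:
  assumes R: "bohr_recurrent R" "0 \<notin> R" and W: "open W" "0 \<in> W" and s: "s \<ge> 1"
  shows "\<exists>n\<in>R. \<exists>g\<in>W. \<exists>v\<in>W. \<exists>\<gamma>\<in>\<Gamma>. - g + nmul n \<tau> + g = v + \<gamma>"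
proof -
  have "\<exists>n\<in>R. returns (Suc j) n W" if "bohr_recurrent R" "0 \<notin> R" "open W" "0 \<in> W" for j R W
    using that
  proof (induction j arbitrary: R W)
    case 0
    then show ?case using returns_base[of R W] by simp
  next
    case (Suc j)
    then show ?case using returns_step[of j R W] by blast
  qed
  from this[of R W "s - 1"] obtain n where n: "n \<in> R" "returns s n W" using R W s by auto
  have "x = y" if "eqv s x y" for x y
    using that low_subset_lcs[of s] nilpotent by (auto simp: eqv_def add_eq_0_iff)
  then show ?thesis using n unfolding returns_def by blast
qed

end

section \<open>The quotient space\<close>

lemma coset_eq:
  assumes "subgroup_of \<Gamma>" "C \<in> cosets \<Gamma>" "x \<in> C"
  shows "C = (+) x ` \<Gamma>"
proof -
  obtain g \<delta> where g: "C = (+) g ` \<Gamma>" "\<delta> \<in> \<Gamma>" "x = g + \<delta>" using assms unfolding cosets_def by blast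
  have "g + \<gamma> \<in> (+) x ` \<Gamma>" if "\<gamma> \<in> \<Gamma>" for \<gamma>
  proof -
    have "g + \<gamma> = x + (- \<delta> + \<gamma>)" by (simp add: g(3) add.assoc)
    then show ?thesis using that g(2) assms(1) by (auto simp: subgroup_of_def)
  qed
  moreover have "x + \<gamma> \<in> (+) g ` \<Gamma>" if "\<gamma> \<in> \<Gamma>" for \<gamma>
    using that g assms(1) by (auto simp: subgroup_of_def add.assoc)
  ultimately show ?thesis using g(1) by auto
qed

lemma coset_mem: "(+) x ` \<Gamma> \<in> cosets \<Gamma>"
  by (auto simp: cosets_def)

lemma Union_cosets: "subgroup_of \<Gamma> \<Longrightarrow> \<Union>(cosets \<Gamma>) = UNIV"
  by (force simp: cosets_def subgroup_of_def)

text \<open>The open sets of a space built with \<open>topology\<close> are known only once the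
  axioms are checked. The case of intersections rests on the disjointness of distinct
  cosets.\<close>

lemma openin_quot_top:
  assumes "subgroup_of \<Gamma>"
  shows "openin (quot_top \<Gamma>) U \<longleftrightarrow> U \<subseteq> cosets \<Gamma> \<and> open (\<Union>U)"
proof -
  have "istopology (\<lambda>U. U \<subseteq> cosets \<Gamma> \<and> open (\<Union>U))"
    unfolding istopology_def
  proof (intro conjI allI impI)
    fix S T assume ST: "S \<subseteq> cosets \<Gamma> \<and> open (\<Union>S)" "T \<subseteq> cosets \<Gamma> \<and> open (\<Union>T)"
    have "\<Union>(S \<inter> T) = \<Union>S \<inter> \<Union>T"
    proof
      show "\<Union>S \<inter> \<Union>T \<subseteq> \<Union>(S \<inter> T)"
      proof
        fix x assume "x \<in> \<Union>S \<inter> \<Union>T"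
        then obtain C C' where C: "C \<in> S" "x \<in> C" "C' \<in> T" "x \<in> C'" by blast
        then have "C = (+) x ` \<Gamma>" "C' = (+) x ` \<Gamma>" using coset_eq[OF assms] ST by blast+
        then show "x \<in> \<Union>(S \<inter> T)" using C by blast
      qed
    qed blast
    then show "open (\<Union>(S \<inter> T))" using ST by auto
  next
    fix \<K> assume K: "\<forall>K\<in>\<K>. K \<subseteq> cosets \<Gamma> \<and> open (\<Union>K)"
    then have "open (\<Union>K\<in>\<K>. \<Union>K)" by blast
    moreover have "(\<Union>K\<in>\<K>. \<Union>K) = \<Union>(\<Union>\<K>)" by blast
    ultimately show "open (\<Union>(\<Union>\<K>))" by simp
  qed auto
  then show ?thesis unfolding quot_top_def by (simp add: topology_inverse')
qed

lemma topspace_quot_top: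
  assumes "subgroup_of (\<Gamma> :: 'g::{group_add,topological_space} set)"
  shows "topspace (quot_top \<Gamma>) = cosets \<Gamma>"
proof
  show "topspace (quot_top \<Gamma>) \<subseteq> cosets \<Gamma>"
    using openin_topspace[of "quot_top \<Gamma>"] openin_quot_top[OF assms] by blast
  show "cosets \<Gamma> \<subseteq> topspace (quot_top \<Gamma>)"
    by (rule openin_subset) (simp add: openin_quot_top[OF assms] Union_cosets[OF assms])
qed

text \<open>Together with \<open>Union_cosets_meeting\<close> this says that the quotient map is
  open.\<close>

lemma open_saturation:
  fixes U :: "'g::{group_add,topological_space} set"
  assumes "topological_group TYPE('g)" "open U"
  shows "open {x. \<exists>\<gamma>\<in>\<Gamma>. x + \<gamma> \<in> U}"
proof -
  have "open ((\<lambda>x. x + \<gamma>) -` U)" for \<gamma>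
    by (intro open_vimage assms continuous_on_group_add continuous_on_id continuous_on_const)
  then have "open (\<Union>\<gamma>\<in>\<Gamma>. (\<lambda>x. x + \<gamma>) -` U)" by blast
  moreover have "(\<Union>\<gamma>\<in>\<Gamma>. (\<lambda>x. x + \<gamma>) -` U) = {x. \<exists>\<gamma>\<in>\<Gamma>. x + \<gamma> \<in> U}" by auto
  ultimately show ?thesis by simp
qed

lemma Union_cosets_meeting:
  assumes "subgroup_of \<Gamma>"
  shows "\<Union>{C \<in> cosets \<Gamma>. C \<inter> U \<noteq> {}} = {x. \<exists>\<gamma>\<in>\<Gamma>. x + \<gamma> \<in> U}"
proof
  show "\<Union>{C \<in> cosets \<Gamma>. C \<inter> U \<noteq> {}} \<subseteq> {x. \<exists>\<gamma>\<in>\<Gamma>. x + \<gamma> \<in> U}"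
    using coset_eq[OF assms] by (auto simp: image_iff)
  show "{x. \<exists>\<gamma>\<in>\<Gamma>. x + \<gamma> \<in> U} \<subseteq> \<Union>{C \<in> cosets \<Gamma>. C \<inter> U \<noteq> {}}"
  proof
    fix x assume "x \<in> {x. \<exists>\<gamma>\<in>\<Gamma>. x + \<gamma> \<in> U}"
    then have "(+) x ` \<Gamma> \<inter> U \<noteq> {}" by blast
    moreover have "x \<in> (+) x ` \<Gamma>" using assms by (force simp: subgroup_of_def)
    ultimately show "x \<in> \<Union>{C \<in> cosets \<Gamma>. C \<inter> U \<noteq> {}}" using coset_mem by blast
  qed
qed

text \<open>The cover is pushed down by the open quotient map, and a finite subcover is lifted
  back.\<close>

lemma quot_top_finite_cover:
  fixes \<Gamma> :: "'g::{group_add,topological_space} set"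
  assumes tg: "topological_group TYPE('g)" and sub: "subgroup_of \<Gamma>" and c: "compact_space (quot_top \<Gamma>)"
    and O: "\<And>U. U \<in> \<O> \<Longrightarrow> open U" "\<Union>\<O> = UNIV"
  shows "\<exists>\<F>. finite \<F> \<and> \<F> \<subseteq> \<O> \<and> (\<forall>x. \<exists>U\<in>\<F>. \<exists>u\<in>U. \<exists>\<gamma>\<in>\<Gamma>. x = u + \<gamma>)"
proof -
  define q where "q U = {C \<in> cosets \<Gamma>. C \<inter> U \<noteq> {}}" for U
  have "openin (quot_top \<Gamma>) (q U)" if "U \<in> \<O>" for U
    unfolding openin_quot_top[OF sub] q_def Union_cosets_meeting[OF sub]
    using open_saturation[OF tg O(1)[OF that]] by auto
  moreover have "topspace (quot_top \<Gamma>) \<subseteq> \<Union>(q ` \<O>)"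
  proof
    fix C assume "C \<in> topspace (quot_top \<Gamma>)"
    then have C: "C \<in> cosets \<Gamma>" by (simp add: topspace_quot_top[OF sub])
    then obtain x where "x \<in> C" using sub by (auto simp: cosets_def subgroup_of_def)
    then show "C \<in> \<Union>(q ` \<O>)" using C O(2) by (auto simp: q_def)
  qed
  ultimately obtain \<G> where G: "finite \<G>" "\<G> \<subseteq> q ` \<O>" "topspace (quot_top \<Gamma>) \<subseteq> \<Union>\<G>"
    using c unfolding compact_space_alt by (metis (no_types, lifting) imageE)
  from finite_subset_image[OF G(1,2)] obtain \<F> where F: "\<F> \<subseteq> \<O>" "finite \<F>" "\<G> = q ` \<F>" by blast
  have "\<exists>U\<in>\<F>. \<exists>u\<in>U. \<exists>\<gamma>\<in>\<Gamma>. x = u + \<gamma>" for x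
  proof -
    have "(+) x ` \<Gamma> \<in> \<Union>\<G>" using G(3) coset_mem topspace_quot_top[OF sub] by blast
    then obtain U where U: "U \<in> \<F>" "(+) x ` \<Gamma> \<inter> U \<noteq> {}" using F(3) by (auto simp: q_def)
    then obtain \<gamma> where \<gamma>: "\<gamma> \<in> \<Gamma>" "x + \<gamma> \<in> U" by blast
    have "x = (x + \<gamma>) + - \<gamma>" by (simp add: add.assoc)
    then show ?thesis using U \<gamma> sub unfolding subgroup_of_def by blast
  qed
  then show ?thesis using F by blast
qed

lemma transl_funpow: "(transl \<tau> ^^ n) C = (+) (nmul n \<tau>) ` C"
proof (induction n)
  case (Suc n)
  then show ?case by (auto simp: transl_def image_image add.assoc)
qed auto

lemma transl_coset: "transl \<tau> ((+) x ` \<Gamma>) = (+) (\<tau> + x) ` \<Gamma>"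
  by (auto simp: transl_def image_image add.assoc)

text \<open>The cosets whose forward translates all miss \<open>U\<close> form a closed invariant
  set. If the orbit of \<open>x\<close> missed \<open>U\<close>, this set would be nonempty, hence
  everything by minimality, although \<open>U\<close> is nonempty.\<close>

lemma minimal_dense_orbit:
  fixes \<Gamma> :: "'g::{group_add,topological_space} set"
  assumes tg: "topological_group TYPE('g)" and sub: "subgroup_of \<Gamma>" and min: "minimal_nilsystem \<Gamma> \<tau>"
    and U: "open U" "U \<noteq> {}"
  shows "\<exists>n. \<exists>\<gamma>\<in>\<Gamma>. nmul n \<tau> + x + \<gamma> \<in> U"
proof (rule ccontr)
  assume neg: "\<not> ?thesis"
  define V where "V = (\<Union>n. {y. nmul n \<tau> + y \<in> U})"
  define B where "B = {C \<in> cosets \<Gamma>. C \<inter> V \<noteq> {}}"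
  define A where "A = cosets \<Gamma> - B"
  have "open {y. nmul n \<tau> + y \<in> U}" for n
  proof -
    have "open ((\<lambda>y. nmul n \<tau> + y) -` U)"
      by (intro open_vimage U tg continuous_on_group_add continuous_on_id continuous_on_const)
    then show ?thesis by (simp add: vimage_def)
  qed
  then have "open V" unfolding V_def by blast
  then have "openin (quot_top \<Gamma>) B"
    unfolding openin_quot_top[OF sub] B_def Union_cosets_meeting[OF sub]
    using open_saturation[OF tg] by auto
  then have "closedin (quot_top \<Gamma>) A"
    unfolding A_def topspace_quot_top[OF sub, symmetric] by (intro closedin_diff closedin_topspace)
  moreover have "transl \<tau> ` A \<subseteq> A"
  proof
    fix D assume "D \<in> transl \<tau> ` A"
    then obtain C where C: "C \<in> cosets \<Gamma>" "C \<inter> V = {}" "D = transl \<tau> C" by (auto simp: A_def B_def)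
    have "D \<in> cosets \<Gamma>" using C(1,3) transl_coset coset_mem unfolding cosets_def by blast
    moreover have "D \<inter> V = {}"
    proof (rule ccontr)
      assume "D \<inter> V \<noteq> {}"
      then obtain y n where y: "y \<in> C" "nmul n \<tau> + (\<tau> + y) \<in> U" using C by (auto simp: V_def transl_def)
      then have "nmul (Suc n) \<tau> + y \<in> U" by (simp add: nmul_commute[symmetric] add.assoc)
      then show False using C(2) y(1) unfolding V_def by blast
    qed
    ultimately show "D \<in> A" by (simp add: A_def B_def)
  qed
  moreover have "(+) x ` \<Gamma> \<in> A"
    using neg coset_mem by (fastforce simp: A_def B_def V_def add.assoc)
  ultimately have A: "A = cosets \<Gamma>" using min unfolding minimal_nilsystem_def by blast
  obtain u where u: "u \<in> U" using U by blast
  have "u \<in> V" unfolding V_def using u by (intro UN_I[of 0]) auto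
  moreover have "u \<in> (+) u ` \<Gamma>" using sub by (force simp: subgroup_of_def)
  ultimately have "(+) u ` \<Gamma> \<in> B" unfolding B_def using coset_mem[of u \<Gamma>] by blast
  moreover have "(+) u ` \<Gamma> \<in> A" unfolding A by (rule coset_mem)
  ultimately show False unfolding A_def by blast
qed

theorem mainTheorem6:
  fixes R :: "nat set" and s :: nat and \<Gamma> :: "'g::{group_add,topological_space} set"
    and \<tau> :: 'g
  assumes "bohr_recurrent R"
    and "s \<ge> 1"
    and "lie_group TYPE('e::euclidean_space) TYPE('g)"
    and "nilpotent_step s TYPE('g)"
    and "discrete_cocompact \<Gamma>"
    and "minimal_nilsystem \<Gamma> \<tau>"
  shows "\<forall>U. openin (quot_top \<Gamma>) U \<and> U \<noteq> {} \<longrightarrow>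
           (\<exists>n\<in>R. U \<inter> {x \<in> cosets \<Gamma>. (transl \<tau> ^^ n) x \<in> U} \<noteq> {})"
proof (intro allI impI)
  fix U assume U: "openin (quot_top \<Gamma>) U \<and> U \<noteq> {}"
  have tg: "topological_group TYPE('g)" using assms(3) by (simp add: lie_group_def)
  have sub: "subgroup_of \<Gamma>" and cpt: "compact_space (quot_top \<Gamma>)"
    using assms(5) by (auto simp: discrete_cocompact_def)
  have Uc: "U \<subseteq> cosets \<Gamma>" and oU: "open (\<Union>U)" using U openin_quot_top[OF sub] by auto
  obtain C0 where C0: "C0 \<in> U" using U by blast
  show "\<exists>n\<in>R. U \<inter> {x \<in> cosets \<Gamma>. (transl \<tau> ^^ n) x \<in> U} \<noteq> {}"
  proof (cases "0 \<in> R")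
    case True
    then show ?thesis using C0 Uc by (intro bexI[of _ 0]) auto
  next
    case False
    obtain g0 where g0: "g0 \<in> C0" using C0 Uc sub by (auto simp: cosets_def subgroup_of_def)
    \<comment> \<open>Conjugation moves the base point \<open>g0\<close> to the identity: \<tau>' is
      \<tau> in the coordinates \<open>x \<mapsto> g0 + x\<close>.\<close>
    define \<tau>' where "\<tau>' = - g0 + \<tau> + g0"
    have nmul': "nmul n \<tau>' = - g0 + nmul n \<tau> + g0" for n
      using nmul_conj[of n "- g0" \<tau>] by (simp add: \<tau>'_def)
    interpret nilrotation \<Gamma> \<tau>' s
    proof
      show "lcs s = ({0} :: 'g set)" using assms(4) by (simp add: nilpotent_step_def)
      show "\<exists>n. \<exists>\<gamma>\<in>\<Gamma>. nmul n \<tau>' + x + \<gamma> \<in> V" if V: "open V" "V \<noteq> {}" for x V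
      proof -
        define V' where "V' = (\<lambda>y. - g0 + y) -` V"
        have "open V'" unfolding V'_def
          by (intro open_vimage V tg continuous_on_group_add continuous_on_id continuous_on_const)
        moreover obtain v where "v \<in> V" using V by blast
        then have "g0 + v \<in> V'" by (simp add: V'_def)
        ultimately obtain n \<gamma> where "\<gamma> \<in> \<Gamma>" "nmul n \<tau> + (g0 + x) + \<gamma> \<in> V'"
          using minimal_dense_orbit[OF tg sub assms(6), of V' "g0 + x"] by blast
        then show ?thesis
          by (intro exI[of _ n] bexI[of _ \<gamma>]) (auto simp: V'_def nmul' add.assoc)
      qed
    qed (fact tg sub quot_top_finite_cover[OF tg sub cpt] lie_group_small_divisible_nhd[OF assms(3)])+
    define W0 where "W0 = {x. g0 + x \<in> \<Union>U}"
    have W0: "open W0" "0 \<in> W0"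
      using open_translate_left[OF oU] g0 C0 by (auto simp: W0_def)
    obtain W where W: "open W" "0 \<in> W" "\<And>x y. x \<in> W \<Longrightarrow> y \<in> W \<Longrightarrow> x + y \<in> W0"
      using nhd_add[OF W0] by metis
    obtain n g v \<gamma> where n: "n \<in> R" "g \<in> W" "v \<in> W" "\<gamma> \<in> \<Gamma>" "- g + nmul n \<tau>' + g = v + \<gamma>"
      using bohr_recurrent_returns[OF assms(1) False W(1,2) assms(2)] by blast
    have inU: "(+) x ` \<Gamma> \<in> U" if "x \<in> \<Union>U" for x
    proof -
      obtain C where "C \<in> U" "x \<in> C" using \<open>x \<in> \<Union>U\<close> by blast
      then show ?thesis using coset_eq[OF sub, of C x] Uc by auto
    qed
    \<comment> \<open>The recurrent point is the coset of \<open>g0 + g\<close>; after time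
      \<open>n\<close> it becomes the coset of \<open>g0 + (g + v)\<close>, and the choice of
      \<open>W\<close> keeps both in \<open>U\<close>.\<close>
    have "g + 0 \<in> W0" "g + v \<in> W0" using n W by blast+
    then have mem: "(+) (g0 + g) ` \<Gamma> \<in> U" "(+) (g0 + (g + v)) ` \<Gamma> \<in> U"
      by (auto simp: W0_def intro!: inU)
    have "nmul n \<tau> + (g0 + g) = (g0 + g) + (- g + nmul n \<tau>' + g)"
      by (simp add: nmul' group_word del: add_uminus_conv_diff)
    also have "\<dots> = g0 + (g + v) + \<gamma>" unfolding n(5) by (simp only: add.assoc)
    finally have eq: "nmul n \<tau> + (g0 + g) = g0 + (g + v) + \<gamma>" .
    have tr: "(transl \<tau> ^^ n) ((+) (g0 + g) ` \<Gamma>) = (+) (nmul n \<tau> + (g0 + g)) ` \<Gamma>"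
      by (auto simp: transl_funpow image_image add.assoc)
    have "nmul n \<tau> + (g0 + g) \<in> (+) (g0 + (g + v)) ` \<Gamma>" using n(4) eq by blast
    then have "(transl \<tau> ^^ n) ((+) (g0 + g) ` \<Gamma>) = (+) (g0 + (g + v)) ` \<Gamma>"
      using coset_eq[OF sub coset_mem] tr by metis
    then have "(+) (g0 + g) ` \<Gamma> \<in> U \<inter> {x \<in> cosets \<Gamma>. (transl \<tau> ^^ n) x \<in> U}"
      using mem coset_mem by auto
    then show ?thesis using n(1) by blast
  qed
qed

end
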